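(* Let $K$ be a field, let $L$ be a nonzero positive sublattice of $\mathbb{Z}^m$ and let $(L,\rho)$ be a partial character on $\mathbb{Z}^m$. Then the lattice ideal $I_{L,\rho}$ is complete intersection if and only if for every face $\mathcal{F}$ of $\sigma_L$ the lattice ideal $I_{L\cap\mathbb{Z}^{\mathbb{E}_{\mathcal{F}}},\rho}$ is complete intersection.
   Context: A partial character $(L,\rho)$ on $\mathbb{Z}^m$ is a homomorphism $\rho$ from a sublattice (subgroup) $L$ of $\mathbb{Z}^m$ to the multiplicative group $K^*=K\setminus\{0\}$. The lattice $L$ is positive if $L\cap\mathbb{N}^m=\{\mathbf{0}\}$. Every $\mathbf{u}\in\mathbb{Z}^m$ is written uniquely as $\mathbf{u}=\mathbf{u}_+-\mathbf{u}_-$ with $\mathbf{u}_+,\mathbf{u}_-$ non-negative with disjoint supports, where ${\rm supp}(\mathbf{u})=\{i: u_i\neq 0\}$. For $\mathbf{u}\in L$ put $B(\mathbf{u}):=\mathbf{x}^{\mathbf{u}_+}-\rho(\mathbf{u})\mathbf{x}^{\mathbf{u}_-}\in K[x_1,\ldots,x_m]$. The lattice ideal $I_{L,\rho}$ is the ideal generated by all $B(\mathbf{u})$, $\mathbf{u}\in L$. For a sublattice $L'\subset L$, $I_{L',\rho}$ denotes the lattice ideal of the partial character $(L',\rho|_{L'})$; when $L'=L\cap\mathbb{Z}^{\mathbb{E}_{\mathcal{F}}}$ (notation below) it is regarded as an ideal of $K[\mathbb{E}_{\mathcal{F}}]=K[x_i : i\in\mathbb{E}_{\mathcal{F}}]$,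 its generators involving only these variables. The saturation of $L$ is $Sat(L)=\{\alpha\in\mathbb{Z}^m : d\alpha\in L \text{ for some } d\in\mathbb{Z}, d\neq 0\}$. Let $n=m-rank(L)$, fix an isomorphism $\psi:\mathbb{Z}^m/Sat(L)\to\mathbb{Z}^n$, and put $\mathbf{a}_i=\psi(\mathbf{e}_i+Sat(L))$ for $1\le i\le m$, where $\mathbf{e}_1,\dots,\mathbf{e}_m$ are the unit vectors of $\mathbb{Z}^m$. Put $A=\{\mathbf{a}_1,\ldots,\mathbf{a}_m\}$ and $\sigma_L=pos_{\mathbb{Q}}(A)=\{\lambda_1\mathbf{a}_1+\cdots+\lambda_m\mathbf{a}_m : \lambda_i\in\mathbb{Q},\ \lambda_i\ge 0\}\subset\mathbb{Q}^n$. A face of $\sigma_L$ is a set of the form $\sigma_L\cap\{\mathbf{x}\in\mathbb{Q}^n:\mathbf{c}\mathbf{x}=0\}$ where $\mathbf{c}\in\mathbb{Q}^n$ and $\mathbf{c}\mathbf{x}\ge 0$ for all $\mathbf{x}\in\sigma_L$ (so $\sigma_L$ itself is a face). For $S\subset\sigma_L$, $\mathbb{E}_S:=\{i\in\{1,\ldots,m\}:\mathbf{a}_i\in S\}$. For $E\subset\{1,\ldots,m\}$, $\mathbb{Z}^E:=\{\mathbf{u}\in\mathbb{Z}^m:{\rm supp}(\mathbf{u})\subset E\}$. An ideal $I$ is a complete intersection if $h(I)=\mu(I)$, where $h(I)$ is the height of $I$ and $\mu(I)$ is the minimal number of generators of $I$. The height of a lattice ideal $I_{L,\rho}$ equals $rank(L)$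 (and the zero ideal has $h=\mu=0$). *)

theory Defs
  imports
    "HOL-Algebra.Algebra"
    "HOL-Algebra.Free_Abelian_Groups"
    "HOL-Algebra.Algebraic_Closure_Type"
    "HOL-Library.Poly_Mapping"
    "HOL-Library.Extended_Nat"
begin

text \<open>The group \<open>\<int>\<^sup>E\<close> is \<^term>\<open>free_Abelian_group E\<close>: integer vectors with support
  (\<^const>\<open>Poly_Mapping.keys\<close>) contained in \<open>E\<close>. In particular \<open>\<int>\<^sup>m\<close> is
  \<^term>\<open>free_Abelian_group {1..m}\<close> with unit vectors \<^term>\<open>frag_of i\<close>.\<close>

section \<open>Heights and complete intersections\<close>

definition prime_height :: "('a, 'b) ring_scheme \<Rightarrow> 'a set \<Rightarrow> enat" where
  "prime_height R P =
     (SUP k \<in> {k. \<exists>C :: nat \<Rightarrow> 'a set. (\<forall>i\<le>k. primeideal (C i) R) \<and>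
                                       (\<forall>i<k. C i \<subset> C (Suc i)) \<and> C k = P}. enat k)"

definition ideal_height :: "('a, 'b) ring_scheme \<Rightarrow> 'a set \<Rightarrow> enat" where
  "ideal_height R I = (INF P \<in> {P. primeideal P R \<and> I \<subseteq> P}. prime_height R P)"

text \<open>The value is \<open>\<infinity>\<close> iff the ideal is not finitely generated.\<close>

definition min_generators :: "('a, 'b) ring_scheme \<Rightarrow> 'a set \<Rightarrow> enat" where
  "min_generators R I =
     (INF G \<in> {G. finite G \<and> G \<subseteq> carrier R \<and> Idl\<^bsub>R\<^esub> G = I}. enat (card G))"

definition complete_intersection :: "('a, 'b) ring_scheme \<Rightarrow> 'a set \<Rightarrow> bool" where
  "complete_intersection R I \<longleftrightarrow> ideal_height R I = min_generators R I"

section \<open>Lattice ideals\<close>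

text \<open>A polynomial maps exponent vectors to coefficients; \<open>mpoly_ring E\<close> is
  \<open>K[x\<^sub>i : i \<in> E]\<close>, with the operations of the ambient type restricted to
  the polynomials in these variables.\<close>

definition mpoly_ring :: "nat set \<Rightarrow> ((nat \<Rightarrow>\<^sub>0 nat) \<Rightarrow>\<^sub>0 'k::field) ring" where
  "mpoly_ring E = ring_of_type_algebra
     \<lparr>carrier := {p. \<forall>t \<in> Poly_Mapping.keys p. Poly_Mapping.keys t \<subseteq> E}\<rparr>"

definition partial_character ::
    "nat \<Rightarrow> (nat \<Rightarrow>\<^sub>0 int) set \<Rightarrow> ((nat \<Rightarrow>\<^sub>0 int) \<Rightarrow> 'k::field) \<Rightarrow> bool" where
  "partial_character m L \<rho> \<longleftrightarrow>
     subgroup L (free_Abelian_group {1..m}) \<and>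
     \<rho> \<in> hom (free_Abelian_group {1..m}\<lparr>carrier := L\<rparr>)
             (Multiplicative_Group.mult_of (ring_of_type_algebra :: 'k ring))"

definition positive_lattice :: "(nat \<Rightarrow>\<^sub>0 int) set \<Rightarrow> bool" where
  "positive_lattice L \<longleftrightarrow> L \<inter> {u. \<forall>i. 0 \<le> Poly_Mapping.lookup u i} = {0}"

text \<open>Since \<^const>\<open>nat\<close> sends negative integers to \<open>0\<close>, \<open>pos_part u\<close> is \<open>u\<^sub>+\<close> and
  \<open>pos_part (- u)\<close> is \<open>u\<^sub>-\<close>.\<close>

definition pos_part :: "(nat \<Rightarrow>\<^sub>0 int) \<Rightarrow> (nat \<Rightarrow>\<^sub>0 nat)" where
  "pos_part u = Poly_Mapping.map nat u"

definition lattice_binomial ::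
    "((nat \<Rightarrow>\<^sub>0 int) \<Rightarrow> 'k::field) \<Rightarrow> (nat \<Rightarrow>\<^sub>0 int) \<Rightarrow> ((nat \<Rightarrow>\<^sub>0 nat) \<Rightarrow>\<^sub>0 'k)" where
  "lattice_binomial \<rho> u =
     Poly_Mapping.single (pos_part u) 1 - Poly_Mapping.single (pos_part (- u)) (\<rho> u)"

text \<open>The ideal of \<open>K[x\<^sub>i : i \<in> E]\<close> generated by the binomials of \<open>L\<close>, for a lattice \<open>L\<close>
  contained in \<open>\<int>\<^sup>E\<close>. It depends on \<open>\<rho>\<close> only through its values on \<open>L\<close>.\<close>

definition lattice_ideal ::
    "nat set \<Rightarrow> (nat \<Rightarrow>\<^sub>0 int) set \<Rightarrow> ((nat \<Rightarrow>\<^sub>0 int) \<Rightarrow> 'k::field) \<Rightarrow> ((nat \<Rightarrow>\<^sub>0 nat) \<Rightarrow>\<^sub>0 'k) set" where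
  "lattice_ideal E L \<rho> = Idl\<^bsub>mpoly_ring E\<^esub> (lattice_binomial \<rho> ` L)"

section \<open>The cone of a lattice\<close>

text \<open>The largest size of a \<open>\<int>\<close>-linearly independent subset. For \<open>L \<subseteq> \<int>\<^sup>m\<close> these sizes
  are at most \<open>m\<close>, so the maximum exists.\<close>

definition lattice_rank :: "(nat \<Rightarrow>\<^sub>0 int) set \<Rightarrow> nat" where
  "lattice_rank L = Max {card B | B. finite B \<and> B \<subseteq> L \<and> \<not> Modules.module.dependent frag_cmul B}"

definition saturation :: "nat \<Rightarrow> (nat \<Rightarrow>\<^sub>0 int) set \<Rightarrow> (nat \<Rightarrow>\<^sub>0 int) set" where
  "saturation m L =
     {\<alpha> \<in> carrier (free_Abelian_group {1..m}). \<exists>d::int. d \<noteq> 0 \<and> frag_cmul d \<alpha> \<in> L}"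

text \<open>Vectors of \<open>\<rat>\<^sup>n\<close> are functions of type \<^typ>\<open>nat \<Rightarrow> rat\<close> whose coordinates outside
  \<^term>\<open>{1..n}\<close> are zero; this holds for \<open>lattice_vec m L \<psi> i\<close> when \<open>\<psi>\<close> takes values in
  \<^term>\<open>carrier (free_Abelian_group {1..n})\<close>.\<close>

definition lattice_vec ::
    "nat \<Rightarrow> (nat \<Rightarrow>\<^sub>0 int) set \<Rightarrow> ((nat \<Rightarrow>\<^sub>0 int) set \<Rightarrow> (nat \<Rightarrow>\<^sub>0 int)) \<Rightarrow> nat \<Rightarrow> (nat \<Rightarrow> rat)" where
  "lattice_vec m L \<psi> i = (\<lambda>j. of_int (Poly_Mapping.lookup
     (\<psi> (saturation m L #>\<^bsub>free_Abelian_group {1..m}\<^esub> frag_of i)) j))"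

definition pos_hull :: "nat \<Rightarrow> (nat \<Rightarrow> (nat \<Rightarrow> rat)) \<Rightarrow> (nat \<Rightarrow> rat) set" where
  "pos_hull m a = {(\<lambda>j. \<Sum>i\<in>{1..m}. c i * a i j) | c. \<forall>i\<in>{1..m}. 0 \<le> c i}"

text \<open>Only the coordinates of \<open>c\<close> in \<^term>\<open>{1..n}\<close> matter, so \<open>c\<close> ranges over \<open>\<rat>\<^sup>n\<close>.\<close>

definition cone_face :: "nat \<Rightarrow> (nat \<Rightarrow> rat) set \<Rightarrow> (nat \<Rightarrow> rat) set \<Rightarrow> bool" where
  "cone_face n \<sigma> F \<longleftrightarrow>
     (\<exists>c :: nat \<Rightarrow> rat. (\<forall>x\<in>\<sigma>. 0 \<le> (\<Sum>j\<in>{1..n}. c j * x j)) \<and>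
                      F = {x \<in> \<sigma>. (\<Sum>j\<in>{1..n}. c j * x j) = 0})"

definition indices_in :: "nat \<Rightarrow> (nat \<Rightarrow> (nat \<Rightarrow> rat)) \<Rightarrow> (nat \<Rightarrow> rat) set \<Rightarrow> nat set" where
  "indices_in m a S = {i \<in> {1..m}. a i \<in> S}"

end

theory Submission
  imports Defs
begin

text \<open>The height of a lattice ideal \<open>I\<^sub>L\<close> equals the rank \<open>r\<close> of \<open>L\<close>. If the strictly increasing
  chain of primes \<open>C\<^sub>0, \<dots>, C\<^sub>k = P\<close> ends in a prime meeting \<open>K[E]\<close> only in \<open>0\<close>, then the variables
  of \<open>E\<close> together with elements \<open>f\<^sub>i \<in> C\<^sub>i - C\<^sub>i\<^sub>-\<^sub>1\<close> are algebraically independent, so that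
  \<open>|E| + k \<le> m\<close> by counting monomials; conversely, contracting \<open>P\<close> to fewer and fewer variables and
  extending again yields a chain and a set \<open>E\<close> with \<open>|E| + k = m\<close>. On the other hand \<open>I\<^sub>L\<close> meets
  \<open>K[E]\<close> only in \<open>0\<close> iff \<open>L\<close> meets \<open>\<int>\<^sup>E\<close> only in \<open>0\<close>, and the largest such \<open>E\<close> has \<open>m - r\<close>
  elements. For positive \<open>L\<close> a graded Nakayama argument replaces any \<open>s\<close> generators of \<open>I\<^sub>L\<close> by at
  most \<open>s\<close> binomials \<open>B(u)\<close>, and the exponents of binomial generators span \<open>L\<close> over \<open>\<rat>\<close>.
  Thus if \<open>I\<^sub>L\<close> is a complete intersection, it is generated by binomials with linearly independent
  exponents. A face is cut out by a nonnegative weight orthogonal to \<open>L\<close>, hence setting the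
  variables off the face to \<open>0\<close> keeps or kills each of these binomials; those that survive
  generate the ideal of the face and are at most as many as its height. The converse is the case
  of the face \<open>\<sigma>\<close> itself.\<close>

section \<open>Polynomial rings\<close>

text \<open>The carrier of \<open>mpoly_ring V\<close>, named so that the algebra below can run on
  the type class operations rather than on record operations.\<close>

definition polys :: "nat set \<Rightarrow> ((nat \<Rightarrow>\<^sub>0 nat) \<Rightarrow>\<^sub>0 'k::field) set" where
  "polys V = {p. \<forall>t \<in> Poly_Mapping.keys p. Poly_Mapping.keys t \<subseteq> V}"

lemma mpoly_ring_simps [simp]:
  "carrier (mpoly_ring V) = polys V"
  "monoid.mult (mpoly_ring V) = (*)"
  "ring.add (mpoly_ring V) = (+)"
  "monoid.one (mpoly_ring V) = 1"
  "ring.zero (mpoly_ring V) = 0"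
  by (auto simp: mpoly_ring_def polys_def ring_of_type_algebra_def)

lemma keys_plus_nat: "Poly_Mapping.keys (s + t :: 'a \<Rightarrow>\<^sub>0 nat) = Poly_Mapping.keys s \<union> Poly_Mapping.keys t"
  by (auto simp: in_keys_iff lookup_add)

lemma polys_0 [simp]: "0 \<in> polys V"
  and polys_1 [simp]: "1 \<in> polys V"
  by (auto simp: polys_def)

lemma polys_add [intro]: "p \<in> polys V \<Longrightarrow> q \<in> polys V \<Longrightarrow> p + q \<in> polys V"
  unfolding polys_def using keys_add[of p q] by blast

lemma polys_uminus [intro]: "p \<in> polys V \<Longrightarrow> - p \<in> polys V"
  unfolding polys_def by (auto simp: in_keys_iff)

lemma polys_diff [intro]: "p \<in> polys V \<Longrightarrow> q \<in> polys V \<Longrightarrow> p - q \<in> polys V"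
  using polys_add[OF _ polys_uminus, of p V q] by simp

lemma polys_mult [intro]: "p \<in> polys V \<Longrightarrow> q \<in> polys V \<Longrightarrow> p * q \<in> polys V"
  unfolding polys_def using keys_mult[of p q] by (fastforce simp: keys_plus_nat)

lemma polys_single [simp]: "Poly_Mapping.single t c \<in> polys V \<longleftrightarrow> c = 0 \<or> Poly_Mapping.keys t \<subseteq> V"
  by (auto simp: polys_def)

lemma polys_sum [intro]: "(\<And>i. i \<in> A \<Longrightarrow> f i \<in> polys V) \<Longrightarrow> sum f A \<in> polys V"
  by (induction A rule: infinite_finite_induct) auto

lemma polys_power [intro]: "p \<in> polys V \<Longrightarrow> p ^ n \<in> polys V"
  by (induction n) auto

lemma polys_prod [intro]: "(\<And>i. i \<in> A \<Longrightarrow> f i \<in> polys V) \<Longrightarrow> prod f A \<in> polys V"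
  by (induction A rule: infinite_finite_induct) auto

lemma polys_mono: "V \<subseteq> W \<Longrightarrow> polys V \<subseteq> polys W"
  by (auto simp: polys_def)

lemma mpoly_ring_cring [simp]: "cring (mpoly_ring V :: ((nat \<Rightarrow>\<^sub>0 nat) \<Rightarrow>\<^sub>0 'k::field) ring)"
proof (rule cringI)
  show "abelian_group (mpoly_ring V :: ((nat \<Rightarrow>\<^sub>0 nat) \<Rightarrow>\<^sub>0 'k) ring)"
  proof (rule abelian_groupI)
    fix x :: "(nat \<Rightarrow>\<^sub>0 nat) \<Rightarrow>\<^sub>0 'k"
    assume "x \<in> carrier (mpoly_ring V)"
    then show "\<exists>y\<in>carrier (mpoly_ring V). y \<oplus>\<^bsub>mpoly_ring V\<^esub> x = \<zero>\<^bsub>mpoly_ring V\<^esub>"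
      by (auto intro!: bexI[of _ "- x"])
  qed (auto simp: add_ac)
  show "Group.comm_monoid (mpoly_ring V :: ((nat \<Rightarrow>\<^sub>0 nat) \<Rightarrow>\<^sub>0 'k) ring)"
    by (rule comm_monoidI) (auto simp: mult_ac)
qed (auto simp: algebra_simps)

lemma mpoly_ring_ring [simp]: "ring (mpoly_ring V :: ((nat \<Rightarrow>\<^sub>0 nat) \<Rightarrow>\<^sub>0 'k::field) ring)"
  using mpoly_ring_cring cring.axioms(1) by blast

lemma poly_mapping_sum_singles:
  "p = (\<Sum>t\<in>Poly_Mapping.keys p. Poly_Mapping.single t (Poly_Mapping.lookup p t))"
  by (rule poly_mapping_eqI) (auto simp: lookup_sum lookup_single when_def in_keys_iff)

lemma poly_mapping_induct_single [case_names zero add]: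
  fixes p :: "'a \<Rightarrow>\<^sub>0 'b::comm_monoid_add"
  assumes "P 0" and "\<And>t c q. t \<in> Poly_Mapping.keys p \<Longrightarrow> P q \<Longrightarrow> P (Poly_Mapping.single t c + q)"
  shows "P p"
proof -
  have "P (\<Sum>t\<in>A. Poly_Mapping.single t (Poly_Mapping.lookup p t))"
    if "finite A" "A \<subseteq> Poly_Mapping.keys p" for A
    using that by (induction rule: finite_induct) (auto intro: assms)
  from this[of "Poly_Mapping.keys p"] show ?thesis
    using poly_mapping_sum_singles[of p] by simp
qed

text \<open>Scaling is multiplication by a constant polynomial, so ideals become subspaces and
  linear algebra over K applies to them.\<close>

interpretation poly: vector_space
  "\<lambda>(c::'k::field) (p :: (nat \<Rightarrow>\<^sub>0 nat) \<Rightarrow>\<^sub>0 'k). Poly_Mapping.single 0 c * p"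
  by unfold_locales (auto simp: algebra_simps single_add mult_single)

subsection \<open>Ideals and prime ideals\<close>

text \<open>Ideals phrased with the operations of the type; \<open>ideal_mpoly_ring_iff\<close> and
  \<open>primeideal_mpoly_ring_iff\<close> link this notion and \<open>poly_prime\<close> to the
  record-based ones.\<close>

definition poly_ideal :: "nat set \<Rightarrow> ((nat \<Rightarrow>\<^sub>0 nat) \<Rightarrow>\<^sub>0 'k::field) set \<Rightarrow> bool" where
  "poly_ideal V J \<longleftrightarrow> J \<subseteq> polys V \<and> 0 \<in> J \<and> (\<forall>a\<in>J. \<forall>b\<in>J. a + b \<in> J) \<and>
     (\<forall>a\<in>J. \<forall>r\<in>polys V. r * a \<in> J)"

definition poly_prime :: "nat set \<Rightarrow> ((nat \<Rightarrow>\<^sub>0 nat) \<Rightarrow>\<^sub>0 'k::field) set \<Rightarrow> bool" where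
  "poly_prime V P \<longleftrightarrow> poly_ideal V P \<and> 1 \<notin> P \<and>
     (\<forall>a\<in>polys V. \<forall>b\<in>polys V. a * b \<in> P \<longrightarrow> a \<in> P \<or> b \<in> P)"

lemma poly_idealD:
  assumes "poly_ideal V J"
  shows "J \<subseteq> polys V" "0 \<in> J" "a \<in> J \<Longrightarrow> b \<in> J \<Longrightarrow> a + b \<in> J"
    "a \<in> J \<Longrightarrow> r \<in> polys V \<Longrightarrow> r * a \<in> J"
  using assms by (auto simp: poly_ideal_def)

lemma poly_ideal_uminus:
  assumes "poly_ideal V J" "a \<in> J"
  shows "- a \<in> J"
  using poly_idealD(4)[OF assms, of "- 1"] polys_uminus[OF polys_1, of V] by simp

lemma poly_ideal_diff:
  assumes "poly_ideal V J" "a \<in> J" "b \<in> J"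
  shows "a - b \<in> J"
  using poly_idealD(3)[OF assms(1,2) poly_ideal_uminus[OF assms(1,3)]] by simp

lemma poly_ideal_sum:
  assumes "poly_ideal V J" "\<And>i. i \<in> A \<Longrightarrow> f i \<in> J"
  shows "sum f A \<in> J"
  using assms(2)
  by (induction A rule: infinite_finite_induct) (auto intro: poly_idealD[OF assms(1)])

lemma poly_ideal_subspace: "poly_ideal V J \<Longrightarrow> poly.subspace J"
  by (rule poly.subspaceI) (auto intro: poly_idealD)

lemma ideal_mpoly_ring_iff: "ideal J (mpoly_ring V) \<longleftrightarrow> poly_ideal V J"
proof
  assume "ideal J (mpoly_ring V)"
  then interpret ideal J "mpoly_ring V" .
  show "poly_ideal V J"
    using additive_subgroup.a_closed[OF is_additive_subgroup]
      additive_subgroup.zero_closed[OF is_additive_subgroup] I_l_closed a_subset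
    by (auto simp: poly_ideal_def)
next
  assume J: "poly_ideal V J"
  show "ideal J (mpoly_ring V)"
  proof (rule idealI)
    have inv: "inv\<^bsub>add_monoid (mpoly_ring V)\<^esub> a = - a" if "a \<in> polys V" for a :: "(nat \<Rightarrow>\<^sub>0 nat) \<Rightarrow>\<^sub>0 'a"
    proof -
      interpret cring "mpoly_ring V :: ((nat \<Rightarrow>\<^sub>0 nat) \<Rightarrow>\<^sub>0 'a) ring" by simp
      show ?thesis
        using minus_equality[of "- a" a] that by (auto simp: a_inv_def)
    qed
    interpret add: group "add_monoid (mpoly_ring V :: ((nat \<Rightarrow>\<^sub>0 nat) \<Rightarrow>\<^sub>0 'a) ring)"
      by (rule abelian_group.a_group) (simp add: ring.is_abelian_group)
    show "subgroup J (add_monoid (mpoly_ring V))"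
      using poly_idealD[OF J] poly_ideal_uminus[OF J] inv
      by (intro add.subgroupI) auto
  qed (use J in \<open>auto simp: poly_ideal_def mult.commute\<close>)
qed

lemma primeideal_mpoly_ring_iff: "primeideal P (mpoly_ring V) \<longleftrightarrow> poly_prime V P"
proof
  assume "primeideal P (mpoly_ring V)"
  then interpret primeideal P "mpoly_ring V" .
  show "poly_prime V P"
    using is_ideal I_notcarr I_prime one_imp_carrier
    by (auto simp: poly_prime_def ideal_mpoly_ring_iff)
next
  assume P: "poly_prime V P"
  then show "primeideal P (mpoly_ring V)"
    by (intro primeidealI) (auto simp: poly_prime_def ideal_mpoly_ring_iff)
qed

lemma poly_primeD:
  assumes "poly_prime V P"
  shows "poly_ideal V P" "1 \<notin> P"
    "a * b \<in> P \<Longrightarrow> a \<in> polys V \<Longrightarrow> b \<in> polys V \<Longrightarrow> a \<in> P \<or> b \<in> P"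
  using assms by (auto simp: poly_prime_def)

lemma poly_prime_power:
  assumes P: "poly_prime V P" and a: "a \<in> polys V" "a ^ n \<in> P"
  shows "a \<in> P"
  using a(2)
proof (induction n)
  case 0
  then show ?case using poly_primeD(2)[OF P] by simp
next
  case (Suc n)
  then show ?case using poly_primeD(3)[OF P, of a "a ^ n"] a(1) by auto
qed

lemma poly_prime_single:
  assumes "poly_prime V P" "Poly_Mapping.single 0 c \<in> P"
  shows "c = 0"
proof (rule ccontr)
  assume "c \<noteq> 0"
  have "Poly_Mapping.single 0 (inverse c) * Poly_Mapping.single 0 c \<in> P"
    using poly_idealD(4)[OF poly_primeD(1)[OF assms(1)] assms(2)] by simp
  then show False using poly_primeD(2)[OF assms(1)] \<open>c \<noteq> 0\<close> by (simp add: mult_single)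
qed

lemma poly_ideal_Idl: "S \<subseteq> polys V \<Longrightarrow> poly_ideal V (Idl\<^bsub>mpoly_ring V\<^esub> S)"
  using ring.genideal_ideal[of "mpoly_ring V" S] by (simp add: ideal_mpoly_ring_iff)

lemma Idl_superset: "S \<subseteq> polys V \<Longrightarrow> S \<subseteq> Idl\<^bsub>mpoly_ring V\<^esub> S"
  using ring.genideal_self[of "mpoly_ring V" S] by simp

lemma Idl_least: "poly_ideal V J \<Longrightarrow> S \<subseteq> J \<Longrightarrow> Idl\<^bsub>mpoly_ring V\<^esub> S \<subseteq> J"
  using ring.genideal_minimal[of "mpoly_ring V" J S] by (simp add: ideal_mpoly_ring_iff)

section \<open>Ideals as spans of monomial multiples of generators\<close>

lemma sum_in_closed:
  assumes "0 \<in> J" "\<And>a b. a \<in> J \<Longrightarrow> b \<in> J \<Longrightarrow> a + b \<in> J" "\<And>i. i \<in> A \<Longrightarrow> f i \<in> J"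
  shows "sum f A \<in> J"
  using assms(3) by (induction A rule: infinite_finite_induct) (auto intro: assms(1,2))

lemma poly_idealI_monomials:
  fixes J :: "((nat \<Rightarrow>\<^sub>0 nat) \<Rightarrow>\<^sub>0 'k::field) set"
  assumes "J \<subseteq> polys V" "0 \<in> J" "\<And>a b. a \<in> J \<Longrightarrow> b \<in> J \<Longrightarrow> a + b \<in> J"
    and mon: "\<And>a t c. a \<in> J \<Longrightarrow> Poly_Mapping.keys t \<subseteq> V \<Longrightarrow> Poly_Mapping.single t c * a \<in> J"
  shows "poly_ideal V J"
  unfolding poly_ideal_def
proof (intro conjI ballI)
  fix a r :: "(nat \<Rightarrow>\<^sub>0 nat) \<Rightarrow>\<^sub>0 'k"
  assume a: "a \<in> J" and r: "r \<in> polys V"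
  have "(\<Sum>t\<in>Poly_Mapping.keys r. Poly_Mapping.single t (Poly_Mapping.lookup r t) * a) \<in> J"
    using r a assms(2,3) mon by (intro sum_in_closed) (auto simp: polys_def)
  then show "r * a \<in> J"
    using poly_mapping_sum_singles[of r] by (simp flip: sum_distrib_right)
qed (use assms in auto)

lemma poly_ideal_span_monomial_multiples:
  fixes S :: "((nat \<Rightarrow>\<^sub>0 nat) \<Rightarrow>\<^sub>0 'k::field) set"
  assumes "S \<subseteq> polys V"
  shows "poly_ideal V (poly.span {Poly_Mapping.single t 1 * f | t f. Poly_Mapping.keys t \<subseteq> V \<and> f \<in> S})"
    (is "poly_ideal V (poly.span ?M)")
proof (rule poly_idealI_monomials)
  have "poly.subspace (polys V)"
    by (rule poly.subspaceI) auto
  then show "poly.span ?M \<subseteq> polys V"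
    using assms by (intro poly.span_minimal) auto
next
  fix a :: "(nat \<Rightarrow>\<^sub>0 nat) \<Rightarrow>\<^sub>0 'k" and t :: "nat \<Rightarrow>\<^sub>0 nat" and c
  assume "a \<in> poly.span ?M" and t: "Poly_Mapping.keys t \<subseteq> V"
  then show "Poly_Mapping.single t c * a \<in> poly.span ?M"
  proof (induction rule: poly.span_induct_alt)
    case base
    then show ?case by (simp add: poly.span_zero)
  next
    case (step d x y)
    from step(1) obtain s f where x: "x = Poly_Mapping.single s 1 * f" "Poly_Mapping.keys s \<subseteq> V" "f \<in> S"
      by blast
    have "Poly_Mapping.single (t + s) 1 * f \<in> ?M"
      using x t by (auto simp: keys_plus_nat intro!: exI[of _ "t + s"] exI[of _ f])
    then have "Poly_Mapping.single 0 (c * d) * (Poly_Mapping.single (t + s) 1 * f) \<in> poly.span ?M"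
      by (intro poly.span_scale poly.span_base)
    moreover have "Poly_Mapping.single t c * (Poly_Mapping.single 0 d * x)
        = Poly_Mapping.single 0 (c * d) * (Poly_Mapping.single (t + s) 1 * f)"
      by (simp add: x mult_single flip: mult.assoc)
    ultimately show ?case
      using step t by (simp add: distrib_left poly.span_add)
  qed
qed (auto intro: poly.span_zero poly.span_add)

text \<open>Every multiplier is a sum of terms, so monomial multiples suffice. Statements about an
  ideal thus reduce to checks on the elements x^t f, for linear functionals, for projections and for
  exchange of spanning elements.\<close>

lemma Idl_eq_span:
  assumes "S \<subseteq> polys V"
  shows "Idl\<^bsub>mpoly_ring V\<^esub> S =
    poly.span {Poly_Mapping.single t 1 * f | t f. Poly_Mapping.keys t \<subseteq> V \<and> f \<in> S}"
    (is "_ = poly.span ?M")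
proof
  have "f \<in> ?M" if "f \<in> S" for f
    using that by (force intro!: exI[of _ 0] exI[of _ f])
  then have "S \<subseteq> poly.span ?M"
    using poly.span_superset by blast
  with Idl_least[OF poly_ideal_span_monomial_multiples[OF assms]]
  show "Idl\<^bsub>mpoly_ring V\<^esub> S \<subseteq> poly.span ?M" .
next
  have I: "poly_ideal V (Idl\<^bsub>mpoly_ring V\<^esub> S)" by (rule poly_ideal_Idl[OF assms])
  show "poly.span ?M \<subseteq> Idl\<^bsub>mpoly_ring V\<^esub> S"
    using Idl_superset[OF assms]
    by (intro poly.span_minimal poly_ideal_subspace[OF I]) (auto intro!: poly_idealD(4)[OF I])
qed

subsection \<open>Algebraic independence modulo an ideal\<close>

definition monom_at :: "(nat \<Rightarrow> (nat \<Rightarrow>\<^sub>0 nat) \<Rightarrow>\<^sub>0 'k::field) \<Rightarrow> (nat \<Rightarrow>\<^sub>0 nat) \<Rightarrow> (nat \<Rightarrow>\<^sub>0 nat) \<Rightarrow>\<^sub>0 'k" where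
  "monom_at g t = (\<Prod>i\<in>Poly_Mapping.keys t. g i ^ Poly_Mapping.lookup t i)"

text \<open>Algebraic independence over K of the classes of the \<open>g i\<close> in the quotient
  by P, stated without forming the quotient. The sum runs over exponents rather than over products,
  so a coincidence of two products counts as a relation.\<close>

definition alg_indep_mod ::
    "((nat \<Rightarrow>\<^sub>0 nat) \<Rightarrow>\<^sub>0 'k::field) set \<Rightarrow> nat set \<Rightarrow> (nat \<Rightarrow> (nat \<Rightarrow>\<^sub>0 nat) \<Rightarrow>\<^sub>0 'k) \<Rightarrow> bool" where
  "alg_indep_mod P I g \<longleftrightarrow>
     (\<forall>T k. finite T \<longrightarrow> (\<forall>t\<in>T. Poly_Mapping.keys t \<subseteq> I) \<longrightarrow>
        (\<Sum>t\<in>T. Poly_Mapping.single 0 (k t) * monom_at g t) \<in> P \<longrightarrow> (\<forall>t\<in>T. k t = 0))"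

lemma alg_indep_modD:
  assumes "alg_indep_mod P I g" "finite T" "\<And>t. t \<in> T \<Longrightarrow> Poly_Mapping.keys t \<subseteq> I"
    "(\<Sum>t\<in>T. Poly_Mapping.single 0 (k t) * monom_at g t) \<in> P" "t \<in> T"
  shows "k t = 0"
  using assms unfolding alg_indep_mod_def by blast

lemma alg_indep_mod_antimono: "alg_indep_mod P I g \<Longrightarrow> Q \<subseteq> P \<Longrightarrow> alg_indep_mod Q I g"
  unfolding alg_indep_mod_def by blast

lemma monom_at_superset:
  assumes "finite I" "Poly_Mapping.keys t \<subseteq> I"
  shows "monom_at g t = (\<Prod>i\<in>I. g i ^ Poly_Mapping.lookup t i)"
  unfolding monom_at_def
  by (rule prod.mono_neutral_left) (use assms in \<open>auto simp: in_keys_iff\<close>)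

lemma monom_at_polys:
  assumes "\<And>i. i \<in> I \<Longrightarrow> g i \<in> polys V" "Poly_Mapping.keys t \<subseteq> I"
  shows "monom_at g t \<in> polys V"
  unfolding monom_at_def using assms by (intro polys_prod polys_power) auto

lemma var_power:
  "Poly_Mapping.single (Poly_Mapping.single i 1) (1::'k::field) ^ n = Poly_Mapping.single (Poly_Mapping.single i n) 1"
  for i :: nat and n :: nat
  by (induction n) (auto simp: mult_single simp flip: single_add)

lemma monom_at_vars: "monom_at (\<lambda>i. Poly_Mapping.single (Poly_Mapping.single i 1) 1) t = Poly_Mapping.single t 1"
proof -
  have "(\<Prod>i\<in>A. Poly_Mapping.single (s i) 1) = Poly_Mapping.single (\<Sum>i\<in>A. s i) (1::'a)"
    if "finite A" for A and s :: "nat \<Rightarrow> (nat \<Rightarrow>\<^sub>0 nat)"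
    using that by (induction rule: finite_induct) (auto simp: mult_single)
  then show ?thesis
    unfolding monom_at_def var_power using poly_mapping_sum_singles[of t] by simp
qed

text \<open>A relation among the variables of E is itself a polynomial of \<open>polys E\<close>
  lying in P, hence 0.\<close>

lemma alg_indep_mod_vars:
  assumes "P \<inter> polys E \<subseteq> {0}"
  shows "alg_indep_mod P E (\<lambda>i. Poly_Mapping.single (Poly_Mapping.single i 1) 1)"
  unfolding alg_indep_mod_def
proof (intro allI impI ballI)
  fix T and k :: "(nat \<Rightarrow>\<^sub>0 nat) \<Rightarrow> 'a" and t
  assume T: "finite T" "\<forall>t\<in>T. Poly_Mapping.keys t \<subseteq> E" and t: "t \<in> T"
    and *: "(\<Sum>t\<in>T. Poly_Mapping.single 0 (k t) *
       monom_at (\<lambda>i. Poly_Mapping.single (Poly_Mapping.single i 1) 1) t) \<in> P"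
  let ?p = "\<Sum>t\<in>T. Poly_Mapping.single t (k t)"
  have "?p \<in> P"
    using * unfolding monom_at_vars by (simp add: mult_single)
  moreover have "?p \<in> polys E"
    using T by (intro polys_sum) auto
  ultimately have "?p = 0" using assms by blast
  moreover have "Poly_Mapping.lookup ?p t = k t"
    using T t by (simp add: lookup_sum lookup_single when_def)
  ultimately show "k t = 0" by simp
qed

text \<open>A relation in \<open>f\<close> over the \<open>g i\<close> modulo \<open>P\<close> can be divided by the largest power of \<open>f\<close>;
  its part free of \<open>f\<close> is then a nontrivial relation modulo \<open>Q\<close>.\<close>

lemma alg_indep_mod_insert:
  assumes P: "poly_prime V P" and Q: "poly_ideal V Q" and "P \<subseteq> Q"
    and f: "f \<in> Q" "f \<notin> P" and indep: "alg_indep_mod Q I g"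
    and I: "finite I" "j \<notin> I" and g: "\<And>i. i \<in> I \<Longrightarrow> g i \<in> polys V"
  shows "alg_indep_mod P (insert j I) (g(j := f))"
  unfolding alg_indep_mod_def
proof (intro allI impI ballI, rule ccontr)
  fix T and k :: "(nat \<Rightarrow>\<^sub>0 nat) \<Rightarrow> 'a" and t0
  assume T: "finite T" "\<forall>t\<in>T. Poly_Mapping.keys t \<subseteq> insert j I" and t0: "t0 \<in> T" "k t0 \<noteq> 0"
    and rel: "(\<Sum>t\<in>T. Poly_Mapping.single 0 (k t) * monom_at (g(j := f)) t) \<in> P"
  have fV: "f \<in> polys V" using f poly_idealD(1)[OF Q] by blast
  define T' where "T' = {t\<in>T. k t \<noteq> 0}"
  \<comment> \<open>All terms with nonzero coefficient share the factor f^s; \<open>r\<close> below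
    deletes the exponent of the new index j.\<close>
  define s where "s = Min ((\<lambda>t. Poly_Mapping.lookup t j) ` T')"
  define r where "r = (\<lambda>t :: nat \<Rightarrow>\<^sub>0 nat. t - Poly_Mapping.single j (Poly_Mapping.lookup t j))"
  have T': "finite T'" "T' \<subseteq> T" "T' \<noteq> {}" using T t0 by (auto simp: T'_def)
  have s_le: "s \<le> Poly_Mapping.lookup t j" if "t \<in> T'" for t
    using that T' by (auto simp: s_def)
  have lookup_r: "Poly_Mapping.lookup (r t) i = (if i = j then 0 else Poly_Mapping.lookup t i)" for t i
    by (auto simp: r_def lookup_minus lookup_single when_def)
  have keys_r: "Poly_Mapping.keys (r t) \<subseteq> I" if "t \<in> T'" for t
  proof
    fix i assume "i \<in> Poly_Mapping.keys (r t)"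
    then have "i \<noteq> j" "i \<in> Poly_Mapping.keys t"
      by (auto simp: in_keys_iff lookup_r split: if_splits)
    then show "i \<in> I" using that T T' by blast
  qed
  have mon: "monom_at (g(j := f)) t = f ^ s * (f ^ (Poly_Mapping.lookup t j - s) * monom_at g (r t))"
    if t: "t \<in> T'" for t
  proof -
    have "monom_at (g(j := f)) t = (\<Prod>i\<in>insert j I. (g(j := f)) i ^ Poly_Mapping.lookup t i)"
      using t T T' I by (intro monom_at_superset) auto
    also have "\<dots> = f ^ Poly_Mapping.lookup t j * (\<Prod>i\<in>I. (g(j := f)) i ^ Poly_Mapping.lookup t i)"
      using I by (simp add: prod.insert)
    also have "(\<Prod>i\<in>I. (g(j := f)) i ^ Poly_Mapping.lookup t i)
        = (\<Prod>i\<in>I. g i ^ Poly_Mapping.lookup (r t) i)"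
      using I by (intro prod.cong) (auto simp: lookup_r)
    also have "\<dots> = monom_at g (r t)"
      using keys_r[OF t] I by (simp add: monom_at_superset)
    also have "f ^ Poly_Mapping.lookup t j = f ^ s * f ^ (Poly_Mapping.lookup t j - s)"
      using s_le[OF t] by (simp flip: power_add)
    finally show ?thesis by (simp only: mult.assoc)
  qed
  define h where "h = (\<lambda>t. Poly_Mapping.single 0 (k t) * (f ^ (Poly_Mapping.lookup t j - s) * monom_at g (r t)))"
  have hV: "h t \<in> polys V" if "t \<in> T'" for t
    unfolding h_def using keys_r[OF that] fV g by (intro polys_mult polys_power monom_at_polys) auto
  have "(\<Sum>t\<in>T. Poly_Mapping.single 0 (k t) * monom_at (g(j := f)) t)
      = (\<Sum>t\<in>T'. Poly_Mapping.single 0 (k t) * monom_at (g(j := f)) t)"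
    by (rule sum.mono_neutral_right) (use T in \<open>auto simp: T'_def\<close>)
  also have "\<dots> = f ^ s * (\<Sum>t\<in>T'. h t)"
    unfolding sum_distrib_left by (rule sum.cong) (simp_all add: h_def mon mult.left_commute)
  finally have "f ^ s * (\<Sum>t\<in>T'. h t) \<in> P" using rel by simp
  then have "f ^ s \<in> P \<or> (\<Sum>t\<in>T'. h t) \<in> P"
    using fV hV by (intro poly_primeD(3)[OF P]) auto
  then have hQ: "(\<Sum>t\<in>T'. h t) \<in> Q"
    using poly_prime_power[OF P fV] f \<open>P \<subseteq> Q\<close> by blast
  define T0 where "T0 = {t\<in>T'. Poly_Mapping.lookup t j = s}"
  \<comment> \<open>Terms whose exponent at j exceeds s keep a factor f, which lies in Q.\<close>
  have "(\<Sum>t\<in>T' - T0. h t) \<in> Q"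
  proof (rule poly_ideal_sum[OF Q])
    fix t assume t: "t \<in> T' - T0"
    then have "s < Poly_Mapping.lookup t j"
      using s_le[of t] by (auto simp: T0_def)
    then obtain n where n: "Poly_Mapping.lookup t j - s = Suc n"
      by (metis Suc_diff_Suc)
    have "h t = (Poly_Mapping.single 0 (k t) * (f ^ n * monom_at g (r t))) * f"
      unfolding h_def n by (simp only: power_Suc mult_ac)
    moreover have "\<dots> \<in> Q"
      using t keys_r fV g by (intro poly_idealD(4)[OF Q f(1)] polys_mult polys_power monom_at_polys[of I]) auto
    ultimately show "h t \<in> Q" by simp
  qed
  then have "(\<Sum>t\<in>T'. h t) - (\<Sum>t\<in>T' - T0. h t) \<in> Q"
    by (rule poly_ideal_diff[OF Q hQ])
  also have "(\<Sum>t\<in>T'. h t) - (\<Sum>t\<in>T' - T0. h t) = (\<Sum>t\<in>T0. h t)"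
    using sum.subset_diff[of T0 T' h] T' by (auto simp: T0_def)
  also have "\<dots> = (\<Sum>t\<in>T0. Poly_Mapping.single 0 (k t) * monom_at g (r t))"
    by (intro sum.cong) (auto simp: h_def T0_def)
  \<comment> \<open>On \<open>T0\<close> the exponent at j is s, so t is recovered from
    \<open>r t\<close> and no two terms merge.\<close>
  also have "\<dots> = (\<Sum>u\<in>r ` T0. Poly_Mapping.single 0 (k (u + Poly_Mapping.single j s)) * monom_at g u)"
  proof (subst sum.reindex)
    have r_inv: "r t + Poly_Mapping.single j s = t" if "t \<in> T0" for t
      using that by (intro poly_mapping_eqI)
        (auto simp: lookup_add lookup_r lookup_single when_def T0_def)
    show "inj_on r T0"
      by (rule inj_on_inverseI[of _ "\<lambda>u. u + Poly_Mapping.single j s"]) (rule r_inv)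
    show "(\<Sum>t\<in>T0. Poly_Mapping.single 0 (k t) * monom_at g (r t)) =
        sum ((\<lambda>u. Poly_Mapping.single 0 (k (u + Poly_Mapping.single j s)) * monom_at g u) \<circ> r) T0"
      by (intro sum.cong) (simp_all add: r_inv)
  qed
  finally have relQ: "(\<Sum>u\<in>r ` T0. Poly_Mapping.single 0 (k (u + Poly_Mapping.single j s)) * monom_at g u) \<in> Q" .
  have "s \<in> (\<lambda>t. Poly_Mapping.lookup t j) ` T'"
    unfolding s_def using T' by (intro Min_in) auto
  then obtain t1 where t1: "t1 \<in> T'" "Poly_Mapping.lookup t1 j = s" by auto
  have "k (r t1 + Poly_Mapping.single j s) = 0"
    by (rule alg_indep_modD[OF indep _ _ relQ]) (use T' t1 keys_r in \<open>auto simp: T0_def\<close>)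
  moreover have "r t1 + Poly_Mapping.single j s = t1"
    using t1 by (intro poly_mapping_eqI) (auto simp: lookup_add lookup_r lookup_single when_def)
  ultimately show False using t1 by (simp add: T'_def)
qed

section \<open>Counting monomials of bounded degree in each variable\<close>

definition exps :: "nat set \<Rightarrow> nat \<Rightarrow> (nat \<Rightarrow>\<^sub>0 nat) set" where
  "exps V d = {t. Poly_Mapping.keys t \<subseteq> V \<and> (\<forall>i\<in>V. Poly_Mapping.lookup t i \<le> d)}"

lemma bij_betw_exps:
  assumes "finite V"
  shows "bij_betw (\<lambda>t. restrict (Poly_Mapping.lookup t) V) (exps V d) (V \<rightarrow>\<^sub>E {..d})"
  unfolding bij_betw_def
proof (intro conjI inj_onI equalityI subsetI)
  fix s t
  assume st: "s \<in> exps V d" "t \<in> exps V d"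
    and eq: "restrict (Poly_Mapping.lookup s) V = restrict (Poly_Mapping.lookup t) V"
  show "s = t"
  proof (rule poly_mapping_eqI)
    fix i show "Poly_Mapping.lookup s i = Poly_Mapping.lookup t i"
    proof (cases "i \<in> V")
      case True
      then show ?thesis using fun_cong[OF eq, of i] by simp
    next
      case False
      then have "i \<notin> Poly_Mapping.keys s" "i \<notin> Poly_Mapping.keys t"
        using st by (auto simp: exps_def)
      then show ?thesis by (simp add: in_keys_iff)
    qed
  qed
next
  fix f assume f: "f \<in> V \<rightarrow>\<^sub>E {..d}"
  let ?t = "\<Sum>i\<in>V. Poly_Mapping.single i (f i)"
  have l: "Poly_Mapping.lookup ?t i = (if i \<in> V then f i else 0)" for i
    using assms by (auto simp: lookup_sum lookup_single when_def)
  have le: "f i \<le> d" if "i \<in> V" for i using f that by auto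
  show "f \<in> (\<lambda>t. restrict (Poly_Mapping.lookup t) V) ` exps V d"
  proof (rule image_eqI)
    show "f = restrict (Poly_Mapping.lookup ?t) V"
    proof
      fix i show "f i = restrict (Poly_Mapping.lookup ?t) V i"
        using PiE_arb[OF f, of i] by (cases "i \<in> V") (simp_all add: l)
    qed
    show "?t \<in> exps V d"
      unfolding exps_def by (simp add: in_keys_iff l le subset_iff)
  qed
qed (auto simp: exps_def)

lemma
  assumes "finite V"
  shows finite_exps: "finite (exps V d)" and card_exps: "card (exps V d) = Suc d ^ card V"
proof -
  show "finite (exps V d)"
    using bij_betw_finite[OF bij_betw_exps[OF assms]] assms by (simp add: finite_PiE)
  show "card (exps V d) = Suc d ^ card V"
    using bij_betw_same_card[OF bij_betw_exps[OF assms]] assms by (simp add: card_PiE)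
qed

lemma exps_mono: "d \<le> d' \<Longrightarrow> exps V d \<subseteq> exps V d'"
  by (force simp: exps_def)

text \<open>Bounding each variable separately makes the bounds add under products, and for finite V
  only \<open>Suc d ^ card V\<close> monomials are available.\<close>

definition bounded_polys :: "nat set \<Rightarrow> nat \<Rightarrow> ((nat \<Rightarrow>\<^sub>0 nat) \<Rightarrow>\<^sub>0 'k::field) set" where
  "bounded_polys V d = {p. Poly_Mapping.keys p \<subseteq> exps V d}"

lemma bounded_polys_mult:
  assumes "p \<in> bounded_polys V d" "q \<in> bounded_polys V e"
  shows "p * q \<in> bounded_polys V (d + e)"
proof -
  have "s + t \<in> exps V (d + e)" if "s \<in> exps V d" "t \<in> exps V e" for s t
    using that by (auto simp: exps_def keys_plus_nat lookup_add intro: add_mono)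
  then show ?thesis
    using keys_mult[of p q] assms unfolding bounded_polys_def by blast
qed

lemma bounded_polys_1: "1 \<in> bounded_polys V 0"
  by (auto simp: bounded_polys_def exps_def)

lemma bounded_polys_power: "p \<in> bounded_polys V d \<Longrightarrow> p ^ n \<in> bounded_polys V (n * d)"
  by (induction n) (auto intro: bounded_polys_mult bounded_polys_1)

lemma bounded_polys_mono: "d \<le> e \<Longrightarrow> bounded_polys V d \<subseteq> bounded_polys V e"
  using exps_mono[of d e V] by (auto simp: bounded_polys_def)

lemma bounded_polys_prod:
  assumes "finite I" "\<And>i. i \<in> I \<Longrightarrow> f i \<in> bounded_polys V d"
  shows "prod f I \<in> bounded_polys V (card I * d)"
  using assms by (induction I rule: finite_induct) (auto intro: bounded_polys_mult bounded_polys_1)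

lemma bounded_polys_span: "bounded_polys V d \<subseteq> poly.span ((\<lambda>s. Poly_Mapping.single s 1) ` exps V d)"
proof
  fix p :: "(nat \<Rightarrow>\<^sub>0 nat) \<Rightarrow>\<^sub>0 'a"
  assume p: "p \<in> bounded_polys V d"
  have "(\<Sum>t\<in>Poly_Mapping.keys p. Poly_Mapping.single 0 (Poly_Mapping.lookup p t) * Poly_Mapping.single t 1)
     \<in> poly.span ((\<lambda>s. Poly_Mapping.single s 1) ` exps V d)"
    using p by (intro poly.span_sum poly.span_scale poly.span_base) (auto simp: bounded_polys_def)
  then show "p \<in> poly.span ((\<lambda>s. Poly_Mapping.single s 1) ` exps V d)"
    using poly_mapping_sum_singles[of p] by (simp add: mult_single)
qed

lemma ex_bounded_polys:
  assumes "finite I" "finite V" "\<And>i. i \<in> I \<Longrightarrow> g i \<in> polys V"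
  shows "\<exists>b. \<forall>i\<in>I. g i \<in> bounded_polys V b"
proof -
  have "finite (\<Union>i\<in>I. \<Union>t\<in>Poly_Mapping.keys (g i). Poly_Mapping.lookup t ` V)"
    using assms by auto
  then obtain b where "\<forall>x\<in>(\<Union>i\<in>I. \<Union>t\<in>Poly_Mapping.keys (g i). Poly_Mapping.lookup t ` V). x \<le> b"
    by (auto simp: finite_nat_set_iff_bounded_le)
  then show ?thesis
    using assms(3) by (intro exI[of _ b]) (auto simp: bounded_polys_def exps_def polys_def, blast)
qed

text \<open>The products of the \<open>g i\<close> with exponents at most D are
  \<open>Suc D ^ card I\<close> independent elements of a space whose dimension grows in D at most
  like the power \<open>card V\<close>. For large D this excludes a larger
  \<open>card I\<close>.\<close>

lemma alg_indep_card_le: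
  fixes g :: "nat \<Rightarrow> (nat \<Rightarrow>\<^sub>0 nat) \<Rightarrow>\<^sub>0 'k::field"
  assumes indep: "alg_indep_mod {0} I g" and fin: "finite I" "finite V"
    and g: "\<And>i. i \<in> I \<Longrightarrow> g i \<in> polys V"
  shows "card I \<le> card V"
proof (rule ccontr)
  assume "\<not> card I \<le> card V"
  then have less: "Suc (card V) \<le> card I" by simp
  obtain b where b: "\<And>i. i \<in> I \<Longrightarrow> g i \<in> bounded_polys V b"
    using ex_bounded_polys[OF fin, of g] g by blast
  have count: "Suc D ^ card I \<le> Suc (card I * (D * b)) ^ card V" for D
  proof -
    let ?S = "(\<lambda>s. Poly_Mapping.single s (1::'k)) ` exps V (card I * (D * b))"
    have inj: "inj_on (monom_at g) (exps I D)"
    proof (rule inj_onI, rule ccontr)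
      fix s t assume st: "s \<in> exps I D" "t \<in> exps I D" "monom_at g s = monom_at g t" "s \<noteq> t"
      \<comment> \<open>Two equal products with distinct exponents would satisfy the relation with
        coefficients 1 and - 1.\<close>
      define k where "k = (\<lambda>u. if u = s then 1 else - 1 :: 'k)"
      have "k s = 0"
        by (rule alg_indep_modD[OF indep, of "{s, t}" k])
          (use st in \<open>auto simp: k_def exps_def single_uminus\<close>)
      then show False by (simp add: k_def)
    qed
    have "poly.independent (monom_at g ` exps I D)"
    proof (rule poly.independent_if_scalars_zero)
      fix f x
      assume *: "(\<Sum>x\<in>monom_at g ` exps I D. Poly_Mapping.single 0 (f x) * x) = 0"
        and x: "x \<in> monom_at g ` exps I D"
      then obtain t where t: "t \<in> exps I D" "x = monom_at g t" by auto
      have "(\<Sum>t\<in>exps I D. Poly_Mapping.single 0 (f (monom_at g t)) * monom_at g t) \<in> {0}"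
        using * by (simp add: sum.reindex[OF inj])
      from alg_indep_modD[OF indep finite_exps[OF fin(1)] _ this t(1)] show "f x = 0"
        using t by (simp add: exps_def)
    qed (simp add: finite_exps fin)
    moreover have "monom_at g ` exps I D \<subseteq> poly.span ?S"
    proof -
      have "monom_at g t \<in> bounded_polys V (card I * (D * b))" if t: "t \<in> exps I D" for t
      proof -
        have "g i ^ Poly_Mapping.lookup t i \<in> bounded_polys V (D * b)" if "i \<in> I" for i
          using bounded_polys_power[OF b[OF that], of "Poly_Mapping.lookup t i"] t that
            bounded_polys_mono[of "Poly_Mapping.lookup t i * b" "D * b" V]
          by (auto simp: exps_def)
        then show ?thesis
          using t fin monom_at_superset[of I t g] by (auto simp: exps_def intro: bounded_polys_prod)
      qed
      then show ?thesis using bounded_polys_span by blast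
    qed
    ultimately have "card (monom_at g ` exps I D) \<le> card ?S"
      using poly.independent_span_bound[of ?S] finite_exps[OF fin(2)] by blast
    also have "\<dots> \<le> Suc (card I * (D * b)) ^ card V"
      using card_image_le[OF finite_exps[OF fin(2)]] card_exps[OF fin(2)] by metis
    finally show ?thesis
      using card_image[OF inj] card_exps[OF fin(1)] by simp
  qed
  \<comment> \<open>The right side of \<open>count\<close> is at most
    \<open>(c * Suc D) ^ card V\<close>; the choice of D turns this into
    \<open>D * Suc D ^ card V\<close>, which is less than
    \<open>Suc D ^ Suc (card V)\<close>.\<close>
  define c where "c = Suc (card I * b)"
  define D where "D = c ^ card V"
  have "Suc D ^ Suc (card V) \<le> Suc D ^ card I"
    using less by (intro power_increasing) auto
  also have "\<dots> \<le> Suc (card I * (D * b)) ^ card V" by (rule count)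
  also have "\<dots> \<le> (c * Suc D) ^ card V"
    by (intro power_mono) (auto simp: c_def algebra_simps)
  also have "\<dots> = D * Suc D ^ card V"
    by (simp only: power_mult_distrib D_def)
  finally have "Suc D * Suc D ^ card V \<le> D * Suc D ^ card V" by simp
  then show False by simp
qed

text \<open>The independent family starts with the variables of E modulo \<open>C k\<close> and
  gains one element at each step down the chain; at the bottom it is independent modulo 0, so it has
  at most \<open>card V\<close> members.\<close>

lemma prime_chain_length_le:
  fixes C :: "nat \<Rightarrow> ((nat \<Rightarrow>\<^sub>0 nat) \<Rightarrow>\<^sub>0 'k::field) set"
  assumes V: "finite V" "E \<subseteq> V"
    and C: "\<And>i. i \<le> k \<Longrightarrow> poly_prime V (C i)" "\<And>i. i < k \<Longrightarrow> C i \<subset> C (Suc i)"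
    and E: "C k \<inter> polys E \<subseteq> {0}"
  shows "card E + k \<le> card V"
proof -
  have "\<exists>I g. finite I \<and> card I = card E + j \<and> (\<forall>i\<in>I. g i \<in> polys V) \<and> alg_indep_mod (C (k - j)) I g"
    if "j \<le> k" for j
    using that
  proof (induction j)
    case 0
    show ?case
      using V finite_subset alg_indep_mod_vars[OF E]
      by (intro exI[of _ E] exI[of _ "\<lambda>i. Poly_Mapping.single (Poly_Mapping.single i 1) 1"]) auto
  next
    case (Suc j)
    then obtain I g where Ig: "finite I" "card I = card E + j" "\<forall>i\<in>I. g i \<in> polys V"
      "alg_indep_mod (C (k - j)) I g"
      by auto
    have k: "k - j = Suc (k - Suc j)" "k - Suc j < k" using Suc.prems by auto
    obtain f where f: "f \<in> C (k - j)" "f \<notin> C (k - Suc j)"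
      using C(2)[OF k(2)] k(1) by auto
    \<comment> \<open>The index set only counts members, so any fresh number can name the new
      element.\<close>
    obtain x where x: "x \<notin> I" using ex_new_if_finite[OF infinite_UNIV_nat Ig(1)] by blast
    have Q: "poly_ideal V (C (k - j))" using C(1)[of "k - j"] poly_primeD(1) by auto
    have "alg_indep_mod (C (k - Suc j)) (insert x I) (g(x := f))"
      by (rule alg_indep_mod_insert[OF C(1) Q _ f Ig(4,1) x]) (use Ig C(2)[OF k(2)] k in auto)
    moreover have "\<forall>i\<in>insert x I. (g(x := f)) i \<in> polys V"
      using Ig f poly_idealD(1)[OF Q] by auto
    ultimately show ?case
      using Ig x by (intro exI[of _ "insert x I"] exI[of _ "g(x := f)"]) (simp del: fun_upd_apply)
  qed
  from this[of k] obtain I g where Ig: "finite I" "card I = card E + k" "\<forall>i\<in>I. g i \<in> polys V"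
    "alg_indep_mod (C 0) I g"
    by auto
  have "alg_indep_mod {0} I g"
    using Ig(4) poly_idealD(2)[OF poly_primeD(1)[OF C(1)[of 0]]] by (auto intro: alg_indep_mod_antimono)
  then show ?thesis
    using alg_indep_card_le[of I g V] Ig V by auto
qed

subsection \<open>Extending primes by one variable\<close>

text \<open>Views f as a univariate polynomial in x_j over the remaining variables. Evaluation at
  x_j gives f back by \<open>poly_poly_in\<close>.\<close>

definition poly_in :: "nat \<Rightarrow> ((nat \<Rightarrow>\<^sub>0 nat) \<Rightarrow>\<^sub>0 'k::field) \<Rightarrow> ((nat \<Rightarrow>\<^sub>0 nat) \<Rightarrow>\<^sub>0 'k) poly" where
  "poly_in j f = (\<Sum>t\<in>Poly_Mapping.keys f. Polynomial.monom
     (Poly_Mapping.single (t - Poly_Mapping.single j (Poly_Mapping.lookup t j)) (Poly_Mapping.lookup f t))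
     (Poly_Mapping.lookup t j))"

lemma poly_in_0 [simp]: "poly_in j 0 = 0"
  by (simp add: poly_in_def)

lemma poly_in_add: "poly_in j (f + g) = poly_in j f + poly_in j g"
  unfolding poly_in_def
  by (rule setsum_keys_plus_distrib) (simp_all add: single_add add_monom)

lemma poly_in_single:
  "poly_in j (Poly_Mapping.single t c) = Polynomial.monom
     (Poly_Mapping.single (t - Poly_Mapping.single j (Poly_Mapping.lookup t j)) c) (Poly_Mapping.lookup t j)"
  by (cases "c = 0") (simp_all add: poly_in_def)

lemma poly_in_mult: "poly_in j (f * g) = poly_in j f * poly_in j g"
proof (induction f rule: poly_mapping_induct_single)
  case (add t c f)
  have "poly_in j (Poly_Mapping.single t c * g) = poly_in j (Poly_Mapping.single t c) * poly_in j g"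
  proof (induction g rule: poly_mapping_induct_single)
    case (add s d g)
    have "s + t - Poly_Mapping.single j (Poly_Mapping.lookup (s + t) j) =
        (s - Poly_Mapping.single j (Poly_Mapping.lookup s j)) + (t - Poly_Mapping.single j (Poly_Mapping.lookup t j))"
      by (rule poly_mapping_eqI) (auto simp: lookup_add lookup_minus lookup_single when_def)
    then show ?case
      using add by (simp add: distrib_left poly_in_add poly_in_single mult_single mult_monom
          lookup_add add.commute)
  qed simp
  then show ?case
    using add by (simp add: distrib_right poly_in_add)
qed simp

lemma poly_poly_in: "Polynomial.poly (poly_in j f) (Poly_Mapping.single (Poly_Mapping.single j 1) 1) = f"
proof (induction f rule: poly_mapping_induct_single)
  case (add t c f)
  have "t - Poly_Mapping.single j (Poly_Mapping.lookup t j) + Poly_Mapping.single j (Poly_Mapping.lookup t j) = t"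
    by (rule poly_mapping_eqI) (auto simp: lookup_add lookup_minus lookup_single when_def)
  then show ?case
    using add unfolding poly_in_add poly_in_single poly_add poly_monom var_power
    by (simp add: mult_single)
qed simp

lemma coeff_poly_in_polys:
  assumes "f \<in> polys (insert j W)"
  shows "Polynomial.coeff (poly_in j f) n \<in> polys W"
proof -
  have "Poly_Mapping.keys (t - Poly_Mapping.single j (Poly_Mapping.lookup t j)) \<subseteq> W"
    if "t \<in> Poly_Mapping.keys f" for t
  proof
    fix i assume "i \<in> Poly_Mapping.keys (t - Poly_Mapping.single j (Poly_Mapping.lookup t j))"
    then have "i \<noteq> j" "i \<in> Poly_Mapping.keys t"
      by (auto simp: in_keys_iff lookup_minus lookup_single when_def split: if_splits)
    then show "i \<in> W" using assms that by (auto simp: polys_def)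
  qed
  then show ?thesis
    unfolding poly_in_def coeff_sum by (intro polys_sum) auto
qed

lemma poly_in_const:
  assumes "f \<in> polys W" "j \<notin> W"
  shows "poly_in j f = [:f:]"
proof -
  have "Poly_Mapping.lookup t j = 0" if "t \<in> Poly_Mapping.keys f" for t
  proof -
    have "j \<notin> Poly_Mapping.keys t" using assms that by (auto simp: polys_def)
    then show ?thesis by (simp add: in_keys_iff)
  qed
  then have "poly_in j f = (\<Sum>t\<in>Poly_Mapping.keys f. [:Poly_Mapping.single t (Poly_Mapping.lookup f t):])"
    unfolding poly_in_def by (intro sum.cong) (auto simp: monom_0)
  also have "\<dots> = [:\<Sum>t\<in>Poly_Mapping.keys f. Poly_Mapping.single t (Poly_Mapping.lookup f t):]"
    by (rule poly_eqI) (auto simp: coeff_sum coeff_pCons split: nat.splits)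
  finally show ?thesis using poly_mapping_sum_singles[of f] by simp
qed

text \<open>For an ideal Q of K[W] and j outside W this is Q[x_j], the extension of Q to one more
  variable.\<close>

definition extend_ideal :: "nat \<Rightarrow> nat set \<Rightarrow> ((nat \<Rightarrow>\<^sub>0 nat) \<Rightarrow>\<^sub>0 'k::field) set \<Rightarrow> ((nat \<Rightarrow>\<^sub>0 nat) \<Rightarrow>\<^sub>0 'k) set" where
  "extend_ideal j W Q = {f \<in> polys (insert j W). \<forall>n. Polynomial.coeff (poly_in j f) n \<in> Q}"

lemma last_coeff_notin:
  assumes "0 \<in> Q" "\<exists>n. Polynomial.coeff p n \<notin> Q"
  obtains m where "Polynomial.coeff p m \<notin> Q" "\<And>n. n > m \<Longrightarrow> Polynomial.coeff p n \<in> Q"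
proof -
  let ?N = "{n. Polynomial.coeff p n \<notin> Q}"
  have "?N \<subseteq> {..Polynomial.degree p}"
    using assms(1) by (auto intro!: le_degree)
  then have fin: "finite ?N" by (rule finite_subset) simp
  show thesis
    using Max_in[OF fin] Max_ge[OF fin] assms(2) by (intro that[of "Max ?N"]) (auto simp: not_less[symmetric])
qed

text \<open>Gauss's argument: if a and b have coefficients outside Q, let m and l be the last such
  indices. Modulo Q the coefficient of a b at m + l is the product of these two, which is outside
  Q.\<close>

lemma extend_ideal_prime:
  fixes Q :: "((nat \<Rightarrow>\<^sub>0 nat) \<Rightarrow>\<^sub>0 'k::field) set"
  assumes Q: "poly_prime W Q" and j: "j \<notin> W"
  shows "poly_prime (insert j W) (extend_ideal j W Q)"
proof -
  note Qi = poly_primeD(1)[OF Q]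
  note Q0 = poly_idealD(2)[OF Qi]
  have QW: "coeff (poly_in j f) n \<in> polys W" if "f \<in> polys (insert j W)" for f :: "(nat \<Rightarrow>\<^sub>0 nat) \<Rightarrow>\<^sub>0 'k" and n
    using that by (rule coeff_poly_in_polys)
  have "poly_ideal (insert j W) (extend_ideal j W Q)"
    unfolding poly_ideal_def
  proof (intro conjI ballI)
    fix a r :: "(nat \<Rightarrow>\<^sub>0 nat) \<Rightarrow>\<^sub>0 'k"
    assume a: "a \<in> extend_ideal j W Q" and r: "r \<in> polys (insert j W)"
    have "coeff (poly_in j (r * a)) n \<in> Q" for n
      unfolding poly_in_mult coeff_mult using a r
      by (intro poly_ideal_sum[OF Qi] poly_idealD(4)[OF Qi] QW) (auto simp: extend_ideal_def)
    then show "r * a \<in> extend_ideal j W Q"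
      using a r by (auto simp: extend_ideal_def)
  qed (auto simp: extend_ideal_def Q0 poly_in_add intro: poly_idealD(3)[OF Qi])
  moreover have "1 \<notin> extend_ideal j W Q"
  proof
    assume "1 \<in> extend_ideal j W Q"
    then have "coeff (poly_in j (1 :: (nat \<Rightarrow>\<^sub>0 nat) \<Rightarrow>\<^sub>0 'k)) 0 \<in> Q" unfolding extend_ideal_def by blast
    then show False using poly_in_const[of "1 :: (nat \<Rightarrow>\<^sub>0 nat) \<Rightarrow>\<^sub>0 'k" W j] j poly_primeD(2)[OF Q] by simp
  qed
  moreover have "a \<in> extend_ideal j W Q \<or> b \<in> extend_ideal j W Q"
    if ab: "a \<in> polys (insert j W)" "b \<in> polys (insert j W)" "a * b \<in> extend_ideal j W Q" for a b
  proof (rule ccontr)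
    assume "\<not> ?thesis"
    then have na: "\<exists>n. coeff (poly_in j a) n \<notin> Q" and nb: "\<exists>n. coeff (poly_in j b) n \<notin> Q"
      using ab by (auto simp: extend_ideal_def)
    obtain m where m: "coeff (poly_in j a) m \<notin> Q" "\<And>n. n > m \<Longrightarrow> coeff (poly_in j a) n \<in> Q"
      using last_coeff_notin[OF Q0 na] by blast
    obtain l where l: "coeff (poly_in j b) l \<notin> Q" "\<And>n. n > l \<Longrightarrow> coeff (poly_in j b) n \<in> Q"
      using last_coeff_notin[OF Q0 nb] by blast
    let ?h = "\<lambda>i. coeff (poly_in j a) i * coeff (poly_in j b) (m + l - i)"
    \<comment> \<open>In every other term one of the two indices lies beyond the last coefficient
      outside Q.\<close>
    have "(\<Sum>i\<in>{..m + l} - {m}. ?h i) \<in> Q"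
    proof (rule poly_ideal_sum[OF Qi])
      fix i assume i: "i \<in> {..m + l} - {m}"
      show "?h i \<in> Q"
      proof (cases "i < m")
        case True
        then show ?thesis using l(2)[of "m + l - i"] QW[OF ab(1)] by (intro poly_idealD(4)[OF Qi]) auto
      next
        case False
        then have "coeff (poly_in j b) (m + l - i) * coeff (poly_in j a) i \<in> Q"
          using i m(2)[of i] QW[OF ab(2)] by (intro poly_idealD(4)[OF Qi]) auto
        then show ?thesis by (simp add: mult.commute)
      qed
    qed
    moreover have "(\<Sum>i\<le>m + l. ?h i) \<in> Q"
    proof -
      have "coeff (poly_in j (a * b)) (m + l) \<in> Q" using ab(3) by (simp add: extend_ideal_def)
      then show ?thesis by (simp add: poly_in_mult coeff_mult)
    qed
    ultimately have "(\<Sum>i\<le>m + l. ?h i) - (\<Sum>i\<in>{..m + l} - {m}. ?h i) \<in> Q"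
      by (rule poly_ideal_diff[OF Qi, rotated])
    moreover have "(\<Sum>i\<le>m + l. ?h i) = ?h m + (\<Sum>i\<in>{..m + l} - {m}. ?h i)"
      by (rule sum.remove) auto
    ultimately have "coeff (poly_in j a) m * coeff (poly_in j b) l \<in> Q" by simp
    then show False
      using poly_primeD(3)[OF Q _ QW[OF ab(1)] QW[OF ab(2)]] m(1) l(1) by blast
  qed
  ultimately show ?thesis unfolding poly_prime_def by blast
qed

text \<open>An element f of Q' outside Q is constant in x_j, so its only nonzero coefficient is f
  itself.\<close>

lemma extend_ideal_strict_mono:
  assumes "Q \<subset> Q'" "Q' \<subseteq> polys W" "j \<notin> W" "0 \<in> Q"
  shows "extend_ideal j W Q \<subset> extend_ideal j W Q'"
proof -
  obtain f where f: "f \<in> Q'" "f \<notin> Q" using assms(1) by blast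
  then have fW: "f \<in> polys W" using assms by blast
  have "coeff [:f:] n \<in> Q'" for n
    using f assms by (cases n) auto
  then have "f \<in> extend_ideal j W Q'"
    using fW polys_mono[of W "insert j W"] poly_in_const[OF fW assms(3)] by (auto simp: extend_ideal_def)
  moreover have "f \<notin> extend_ideal j W Q"
    using poly_in_const[OF fW assms(3)] f by (auto simp: extend_ideal_def intro: exI[of _ 0])
  moreover have "extend_ideal j W Q \<subseteq> extend_ideal j W Q'"
    using assms by (auto simp: extend_ideal_def)
  ultimately show ?thesis by blast
qed

text \<open>Evaluating at x_j writes f as a combination of powers of x_j with coefficients in
  P.\<close>

lemma extend_contracted_ideal_subset:
  assumes P: "poly_ideal (insert j W) P"
  shows "extend_ideal j W (P \<inter> polys W) \<subseteq> P"
proof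
  fix f assume f: "f \<in> extend_ideal j W (P \<inter> polys W)"
  have "Polynomial.poly (poly_in j f) (Poly_Mapping.single (Poly_Mapping.single j 1) 1) \<in> P"
    unfolding poly_altdef
  proof (rule poly_ideal_sum[OF P])
    fix n
    have "Poly_Mapping.single (Poly_Mapping.single j 1) 1 ^ n * coeff (poly_in j f) n \<in> P"
      using f by (intro poly_idealD(4)[OF P] polys_power) (auto simp: extend_ideal_def)
    then show "coeff (poly_in j f) n * Poly_Mapping.single (Poly_Mapping.single j 1) 1 ^ n \<in> P"
      by (simp only: mult.commute)
  qed
  then show "f \<in> P" by (simp only: poly_poly_in)
qed

lemma contract_prime:
  assumes "poly_prime V P" "W \<subseteq> V"
  shows "poly_prime W (P \<inter> polys W)"
proof -
  note P = poly_primeD(1)[OF assms(1)]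
  have "poly_ideal W (P \<inter> polys W)"
    using poly_idealD[OF P] polys_mono[OF assms(2)] by (auto simp: poly_ideal_def)
  then show ?thesis
    using poly_primeD(2,3)[OF assms(1)] polys_mono[OF assms(2)] by (auto simp: poly_prime_def)
qed

text \<open>Contracting P to K[W] and extending back gives a prime inside P. If it equals P, the new
  variable joins E; otherwise P prolongs the chain. Either way \<open>card E + k\<close> grows by
  one.\<close>

lemma ex_prime_chain:
  fixes P :: "((nat \<Rightarrow>\<^sub>0 nat) \<Rightarrow>\<^sub>0 'k::field) set"
  assumes "finite V" "poly_prime V P"
  shows "\<exists>C k E. (\<forall>i\<le>k. poly_prime V (C i)) \<and> (\<forall>i<k. C i \<subset> C (Suc i)) \<and> C k = P \<and>
    E \<subseteq> V \<and> P \<inter> polys E \<subseteq> {0} \<and> card V \<le> card E + k"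
  using assms
proof (induction V arbitrary: P rule: finite_induct)
  case (empty P)
  \<comment> \<open>Without variables every polynomial is constant, and a prime contains no constant
    but 0.\<close>
  have "p = 0" if "p \<in> P" for p
  proof -
    have "p \<in> polys {}" using that empty poly_primeD(1) poly_idealD(1) by blast
    then have "Poly_Mapping.keys p \<subseteq> {0}" by (auto simp: polys_def)
    then have "p = Poly_Mapping.single 0 (Poly_Mapping.lookup p 0)"
      by (intro poly_mapping_eqI) (auto simp: lookup_single when_def in_keys_iff)
    then show ?thesis
      using poly_prime_single[OF empty, of "Poly_Mapping.lookup p 0"] that by (metis single_zero)
  qed
  then show ?case
    using empty by (intro exI[of _ "\<lambda>_. P"] exI[of _ 0] exI[of _ "{}"]) auto
next
  case (insert j W P)
  let ?p = "P \<inter> polys W"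
  have "poly_prime W ?p" using insert.prems by (rule contract_prime) auto
  from insert.IH[OF this] obtain C k E where IH: "\<forall>i\<le>k. poly_prime W (C i)" "\<forall>i<k. C i \<subset> C (Suc i)"
    and C3: "C k = ?p"
    and E: "E \<subseteq> W" "?p \<inter> polys E \<subseteq> {0}" "card W \<le> card E + k"
    by (elim exE conjE) (rule that)
  have C: "\<And>i. i \<le> k \<Longrightarrow> poly_prime W (C i)" "\<And>i. i < k \<Longrightarrow> C i \<subset> C (Suc i)" "C k = ?p"
    using IH C3 by simp_all
  define D where "D = (\<lambda>i. extend_ideal j W (C i))"
  have D: "poly_prime (insert j W) (D i)" if "i \<le> k" for i
    unfolding D_def using C(1)[OF that] insert.hyps by (intro extend_ideal_prime)
  have D_mono: "D i \<subset> D (Suc i)" if "i < k" for i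
    unfolding D_def
    using poly_idealD(1)[OF poly_primeD(1)[OF C(1)[of "Suc i"]]]
      poly_idealD(2)[OF poly_primeD(1)[OF C(1)[of i]]] that insert.hyps
    by (intro extend_ideal_strict_mono C(2)) auto
  have DkP: "D k \<subseteq> P"
    unfolding D_def C(3) by (rule extend_contracted_ideal_subset[OF poly_primeD(1)[OF insert.prems]])
  have finE: "finite E" "j \<notin> E" using E insert.hyps finite_subset by auto
  show ?case
  proof (cases "D k = P")
    case True
    \<comment> \<open>The x_j-coefficients of f lie in the contraction of P and involve only
      variables of E, so they vanish.\<close>
    have "f = 0" if f: "f \<in> P" "f \<in> polys (insert j E)" for f
    proof -
      have "coeff (poly_in j f) n = 0" for n
      proof -
        have "coeff (poly_in j f) n \<in> ?p"
          using f(1) True unfolding D_def C(3) extend_ideal_def by blast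
        then show ?thesis using coeff_poly_in_polys[OF f(2), of n] E(2) by blast
      qed
      then have "poly_in j f = 0" by (intro poly_eqI) simp
      then show ?thesis using poly_poly_in[of j f] by simp
    qed
    then show ?thesis
      using D D_mono True E finE insert.hyps
      by (intro exI[of _ D] exI[of _ k] exI[of _ "insert j E"]) auto
  next
    case False
    let ?C = "\<lambda>i. if i \<le> k then D i else P"
    have "P \<inter> polys E \<subseteq> {0}"
      using E polys_mono[OF E(1)] by blast
    moreover have "\<forall>i<Suc k. ?C i \<subset> ?C (Suc i)"
      using D_mono DkP False by (auto simp: less_Suc_eq)
    moreover have "\<forall>i\<le>Suc k. poly_prime (insert j W) (?C i)"
      using D insert.prems by auto
    ultimately show ?thesis
      using E insert.hyps by (intro exI[of _ ?C] exI[of _ "Suc k"] exI[of _ E]) auto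
  qed
qed

text \<open>Zorn's lemma gives an ideal maximal among those that contain I and avoid the
  multiplicative set S; maximality makes it prime.\<close>

lemma ex_prime_avoiding:
  fixes I :: "((nat \<Rightarrow>\<^sub>0 nat) \<Rightarrow>\<^sub>0 'k::field) set"
  assumes I: "poly_ideal V I" and S: "S \<subseteq> polys V" "1 \<in> S" "\<And>a b. a \<in> S \<Longrightarrow> b \<in> S \<Longrightarrow> a * b \<in> S"
    and disj: "I \<inter> S = {}"
  obtains P where "poly_prime V P" "I \<subseteq> P" "P \<inter> S = {}"
proof -
  let ?A = "{J. poly_ideal V J \<and> I \<subseteq> J \<and> J \<inter> S = {}}"
  have "\<exists>M\<in>?A. \<forall>U\<in>?A. M \<subseteq> U \<longrightarrow> U = M"
  proof (rule subset_Zorn_nonempty)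
    show "?A \<noteq> {}" using I disj by blast
  next
    fix \<C> assume ne: "\<C> \<noteq> {}" and ch: "subset.chain ?A \<C>"
    have sub: "\<C> \<subseteq> ?A" and lin: "\<And>U Y. U \<in> \<C> \<Longrightarrow> Y \<in> \<C> \<Longrightarrow> U \<subseteq> Y \<or> Y \<subseteq> U"
      using ch unfolding subset.chain_def by blast+
    have "poly_ideal V (\<Union>\<C>)"
      unfolding poly_ideal_def
    proof (intro conjI ballI)
      fix a b assume "a \<in> \<Union>\<C>" "b \<in> \<Union>\<C>"
      then obtain U Y where "U \<in> \<C>" "a \<in> U" "Y \<in> \<C>" "b \<in> Y" by blast
      then obtain Z where "Z \<in> \<C>" "a \<in> Z" "b \<in> Z" using lin by blast
      then show "a + b \<in> \<Union>\<C>" using sub poly_idealD(3)[of V Z a b] by blast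
    next
      fix a r :: "(nat \<Rightarrow>\<^sub>0 nat) \<Rightarrow>\<^sub>0 'k"
      assume "a \<in> \<Union>\<C>" "r \<in> polys V"
      then show "r * a \<in> \<Union>\<C>" using sub poly_idealD(4)[of V _ a r] by blast
    qed (use sub ne poly_idealD(1,2) in blast)+
    then show "\<Union>\<C> \<in> ?A" using ne sub by blast
  qed
  then obtain P where PA: "P \<in> ?A" and PM: "\<forall>U\<in>?A. P \<subseteq> U \<longrightarrow> U = P"
    by (elim bexE)
  then have P: "poly_ideal V P" "I \<subseteq> P" "P \<inter> S = {}"
    by simp_all
  have max: "U = P" if "poly_ideal V U" "I \<subseteq> U" "U \<inter> S = {}" "P \<subseteq> U" for U
    using PM that by simp
  have meets: "\<exists>p\<in>P. \<exists>r\<in>polys V. p + r * a \<in> S" if a: "a \<in> polys V" "a \<notin> P" for a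
  proof (rule ccontr)
    assume neg: "\<not> ?thesis"
    \<comment> \<open>The ideal P + (a); it properly contains P, so by maximality it would have to
      meet S.\<close>
    let ?X = "{p + r * a | p r. p \<in> P \<and> r \<in> polys V}"
    have "poly_ideal V ?X"
      unfolding poly_ideal_def
    proof (intro conjI ballI subsetI)
      fix x assume "x \<in> ?X"
      then show "x \<in> polys V" using a poly_idealD(1)[OF P(1)] by auto
    next
      show "0 \<in> ?X" using poly_idealD(2)[OF P(1)] by (force intro: exI[of _ 0])
    next
      fix x y assume "x \<in> ?X" "y \<in> ?X"
      then obtain p r q s where "x = p + r * a" "p \<in> P" "r \<in> polys V" "y = q + s * a" "q \<in> P" "s \<in> polys V"
        by blast
      then show "x + y \<in> ?X"
        using poly_idealD(3)[OF P(1)]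
        by - (rule CollectI, rule exI[of _ "p + q"], rule exI[of _ "r + s"], auto simp: algebra_simps)
    next
      fix x and s :: "(nat \<Rightarrow>\<^sub>0 nat) \<Rightarrow>\<^sub>0 'k"
      assume "x \<in> ?X" and s: "s \<in> polys V"
      then obtain p r where "x = p + r * a" "p \<in> P" "r \<in> polys V" by blast
      then show "s * x \<in> ?X"
        using poly_idealD(4)[OF P(1)] s
        by - (rule CollectI, rule exI[of _ "s * p"], rule exI[of _ "s * r"], auto simp: algebra_simps)
    qed
    moreover have sub: "P \<subseteq> ?X"
    proof
      fix p assume "p \<in> P"
      then show "p \<in> ?X" by - (rule CollectI, rule exI[of _ p], rule exI[of _ 0], auto)
    qed
    moreover have "a \<in> ?X"
      using poly_idealD(2)[OF P(1)] by - (rule CollectI, rule exI[of _ 0], rule exI[of _ 1], auto)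
    ultimately show False
      using max[of ?X] P(2) a(2) neg by blast
  qed
  have "a \<in> P \<or> b \<in> P" if ab: "a \<in> polys V" "b \<in> polys V" "a * b \<in> P" for a b
  proof (rule ccontr)
    assume "\<not> ?thesis"
    then obtain p r q s where 1: "p \<in> P" "r \<in> polys V" "p + r * a \<in> S"
      and 2: "q \<in> P" "s \<in> polys V" "q + s * b \<in> S"
      using meets[OF ab(1)] meets[OF ab(2)] by blast
    \<comment> \<open>The left side is in S as a product, while its expansion consists of multiples
      of p, q and a b, all in P.\<close>
    have "(p + r * a) * (q + s * b) = (q + s * b) * p + (r * a) * q + (r * s) * (a * b)"
      by (simp add: algebra_simps)
    moreover have "\<dots> \<in> P"
      using poly_idealD(4)[OF P(1) 1(1), of "q + s * b"] poly_idealD(4)[OF P(1) 2(1), of "r * a"]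
        poly_idealD(4)[OF P(1) ab(3), of "r * s"] 1 2 S(1) ab
      by (intro poly_idealD(3)[OF P(1)]) auto
    ultimately show False using S(3)[OF 1(3) 2(3)] P(3) by auto
  qed
  then have "poly_prime V P" using P S(2) by (auto simp: poly_prime_def)
  then show thesis using P that by blast
qed

section \<open>Ranks of lattices\<close>

lemma lookup_map_zero: "f 0 = 0 \<Longrightarrow> Poly_Mapping.lookup (Poly_Mapping.map f p) i = f (Poly_Mapping.lookup p i)"
  by (simp add: Poly_Mapping.map.rep_eq when_def)

text \<open>Rational vectors may have any finite support, so lattices in different coordinate sets
  share one vector space.\<close>

interpretation rat_vec: vector_space "\<lambda>(c::rat) (p :: nat \<Rightarrow>\<^sub>0 rat). Poly_Mapping.map ((*) c) p"
  by unfold_locales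
    (auto intro!: poly_mapping_eqI simp: lookup_map_zero lookup_add algebra_simps)

definition to_rat :: "(nat \<Rightarrow>\<^sub>0 int) \<Rightarrow> (nat \<Rightarrow>\<^sub>0 rat)" where
  "to_rat u = Poly_Mapping.map of_int u"

lemma lookup_to_rat: "Poly_Mapping.lookup (to_rat u) i = of_int (Poly_Mapping.lookup u i)"
  by (simp add: to_rat_def lookup_map_zero)

text \<open>The rank of L, taken after passing to rational coefficients so that bases and exchange
  arguments are available.\<close>

definition rat_rank :: "(nat \<Rightarrow>\<^sub>0 int) set \<Rightarrow> nat" where
  "rat_rank L = rat_vec.dim (to_rat ` L)"

definition rat_unit :: "nat \<Rightarrow> (nat \<Rightarrow>\<^sub>0 rat)" where
  "rat_unit i = Poly_Mapping.single i 1"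

lemma inj_rat_unit: "inj_on rat_unit A"
  by (auto simp: inj_on_def rat_unit_def dest!: arg_cong[of _ _ Poly_Mapping.keys])

lemma rat_expansion:
  assumes "finite V" "Poly_Mapping.keys x \<subseteq> V"
  shows "x = (\<Sum>i\<in>V. Poly_Mapping.map ((*) (Poly_Mapping.lookup x i)) (rat_unit i))"
proof (rule poly_mapping_eqI)
  fix j
  have "(\<Sum>i\<in>V. Poly_Mapping.lookup x i * Poly_Mapping.lookup (rat_unit i) j)
      = (\<Sum>i\<in>V. if i = j then Poly_Mapping.lookup x j else 0)"
    by (rule sum.cong) (auto simp: rat_unit_def lookup_single)
  also have "\<dots> = Poly_Mapping.lookup x j"
    using assms by (auto simp: in_keys_iff subset_iff)
  finally show "Poly_Mapping.lookup x j =
      Poly_Mapping.lookup (\<Sum>i\<in>V. Poly_Mapping.map ((*) (Poly_Mapping.lookup x i)) (rat_unit i)) j"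
    by (simp add: lookup_sum lookup_map_zero)
qed

lemma in_span_rat_units:
  assumes "finite V" "Poly_Mapping.keys x \<subseteq> V"
  shows "x \<in> rat_vec.span (rat_unit ` V)"
proof -
  have "(\<Sum>i\<in>V. Poly_Mapping.map ((*) (Poly_Mapping.lookup x i)) (rat_unit i)) \<in> rat_vec.span (rat_unit ` V)"
    by (intro rat_vec.span_sum rat_vec.span_scale rat_vec.span_base) auto
  then show ?thesis using rat_expansion[OF assms] by simp
qed

lemma keys_subset_subspace: "rat_vec.subspace {x. Poly_Mapping.keys x \<subseteq> V}"
proof (rule rat_vec.subspaceI)
  fix c and x :: "nat \<Rightarrow>\<^sub>0 rat"
  assume "x \<in> {x. Poly_Mapping.keys x \<subseteq> V}"
  then show "Poly_Mapping.map ((*) c) x \<in> {x. Poly_Mapping.keys x \<subseteq> V}"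
    by (auto simp: in_keys_iff lookup_map_zero)
next
  fix x y :: "nat \<Rightarrow>\<^sub>0 rat"
  assume "x \<in> {x. Poly_Mapping.keys x \<subseteq> V}" "y \<in> {x. Poly_Mapping.keys x \<subseteq> V}"
  then show "x + y \<in> {x. Poly_Mapping.keys x \<subseteq> V}"
    using keys_add[of x y] by blast
qed simp

lemma span_rat_units_keys: "x \<in> rat_vec.span (rat_unit ` V) \<Longrightarrow> Poly_Mapping.keys x \<subseteq> V"
proof -
  have "rat_unit ` V \<subseteq> {x. Poly_Mapping.keys x \<subseteq> V}" by (auto simp: rat_unit_def)
  from rat_vec.span_minimal[OF this keys_subset_subspace]
  show "x \<in> rat_vec.span (rat_unit ` V) \<Longrightarrow> Poly_Mapping.keys x \<subseteq> V" by blast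
qed

lemma keys_to_rat: "Poly_Mapping.keys (to_rat u) = Poly_Mapping.keys u"
  by (auto simp: in_keys_iff lookup_to_rat)

lemma independent_rat_units: "rat_vec.independent (rat_unit ` V)"
proof
  assume "rat_vec.dependent (rat_unit ` V)"
  then obtain i where i: "i \<in> V" "rat_unit i \<in> rat_vec.span (rat_unit ` V - {rat_unit i})"
    unfolding rat_vec.dependent_def by blast
  have "rat_unit ` V - {rat_unit i} \<subseteq> rat_unit ` (V - {i})" by auto
  then have "rat_unit i \<in> rat_vec.span (rat_unit ` (V - {i}))"
    using i rat_vec.span_mono by blast
  from span_rat_units_keys[OF this] show False by (simp add: rat_unit_def)
qed

locale lattice =
  fixes V :: "nat set" and L :: "(nat \<Rightarrow>\<^sub>0 int) set"
  assumes finite_V: "finite V"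
    and L_keys: "u \<in> L \<Longrightarrow> Poly_Mapping.keys u \<subseteq> V"
    and L_0: "0 \<in> L"
    and L_add: "u \<in> L \<Longrightarrow> v \<in> L \<Longrightarrow> u + v \<in> L"
    and L_uminus: "u \<in> L \<Longrightarrow> - u \<in> L"
begin

lemma L_diff: "u \<in> L \<Longrightarrow> v \<in> L \<Longrightarrow> u - v \<in> L"
  using L_add[OF _ L_uminus, of u v] by simp

lemma L_cmul: "u \<in> L \<Longrightarrow> frag_cmul c u \<in> L"
proof (induction c rule: int_induct[of _ 0])
  case (step1 i)
  then show ?case using L_add[of "frag_cmul i u" u] by (simp add: frag_cmul_distrib)
next
  case (step2 i)
  then show ?case using L_diff[of "frag_cmul i u" u] by (simp add: frag_cmul_diff_distrib)
qed (simp add: L_0)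

text \<open>The denominators met along the combination are multiplied together, which keeps the
  multiplier nonzero.\<close>

lemma span_clear_denominators:
  assumes "x \<in> rat_vec.span (to_rat ` L)"
  shows "\<exists>N u. N \<noteq> 0 \<and> u \<in> L \<and> Poly_Mapping.map ((*) (of_int N)) x = to_rat u"
  using assms
proof (induction rule: rat_vec.span_induct_alt)
  case base
  show ?case
    by (intro exI[of _ 1] exI[of _ 0]) (auto simp: L_0 to_rat_def intro!: poly_mapping_eqI simp: lookup_map_zero)
next
  case (step c x y)
  obtain N u where N: "N \<noteq> 0" "u \<in> L" "Poly_Mapping.map ((*) (of_int N)) y = to_rat u"
    using step by blast
  obtain v where v: "v \<in> L" "x = to_rat v" using step by blast
  obtain p q where pq: "q > 0" "c = of_int p / of_int q"
    using quotient_of_denom_pos quotient_of_div surj_pair by metis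
  let ?w = "frag_cmul (N * p) v + frag_cmul q u"
  have "?w \<in> L" using N v by (intro L_add L_cmul)
  moreover have "Poly_Mapping.map ((*) (of_int (q * N))) (Poly_Mapping.map ((*) c) x + y) = to_rat ?w"
  proof (rule poly_mapping_eqI)
    fix k
    have "of_int N * Poly_Mapping.lookup y k = (of_int (Poly_Mapping.lookup u k) :: rat)"
      using arg_cong[OF N(3), of "\<lambda>z. Poly_Mapping.lookup z k"] by (simp add: lookup_map_zero lookup_to_rat)
    moreover have "of_int q * c = of_int p" using pq by simp
    moreover have "of_int (q * N) * (c * z + y') = of_int N * (of_int q * c) * z + of_int q * (of_int N * y')"
      for z y' :: rat
      by (simp add: algebra_simps)
    ultimately show "Poly_Mapping.lookup (Poly_Mapping.map ((*) (of_int (q * N))) (Poly_Mapping.map ((*) c) x + y)) k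
      = Poly_Mapping.lookup (to_rat ?w) k"
      by (simp add: lookup_map_zero lookup_add lookup_to_rat v(2))
  qed
  ultimately show ?case using N(1) pq(1) by (intro exI[of _ "q * N"] exI[of _ ?w]) simp
qed

lemma to_rat_L_span: "to_rat ` L \<subseteq> rat_vec.span (rat_unit ` V)"
  using in_span_rat_units[OF finite_V] L_keys by (auto simp: keys_to_rat)

lemma basis:
  obtains B where "B \<subseteq> to_rat ` L" "rat_vec.independent B" "to_rat ` L \<subseteq> rat_vec.span B"
    "finite B" "card B = rat_rank L"
proof -
  obtain B where B: "B \<subseteq> to_rat ` L" "rat_vec.independent B" "to_rat ` L \<subseteq> rat_vec.span B"
    "card B = rat_vec.dim (to_rat ` L)"
    using rat_vec.basis_exists[of "to_rat ` L"] by blast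
  have "finite B"
    using rat_vec.independent_span_bound[of "rat_unit ` V" B] B to_rat_L_span finite_V by blast
  then show thesis using that B by (simp add: rat_rank_def)
qed

text \<open>A basis of the rational span of L stays independent when the unit vectors of E are added
  one by one: after clearing denominators a dependence would give a nonzero vector of L supported in
  E, or a dependence among unit vectors.\<close>

lemma card_plus_rank_le:
  assumes E: "E \<subseteq> V" "\<And>u. u \<in> L \<Longrightarrow> Poly_Mapping.keys u \<subseteq> E \<Longrightarrow> u = 0"
  shows "card E + rat_rank L \<le> card V"
proof -
  obtain B where B: "B \<subseteq> to_rat ` L" "rat_vec.independent B" "finite B" "card B = rat_rank L"
    using basis by metis
  have ind: "rat_vec.independent (B \<union> rat_unit ` E') \<and> card (B \<union> rat_unit ` E') = rat_rank L + card E'"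
    if "finite E'" "E' \<subseteq> E" for E'
    using that
  proof (induction rule: finite_induct)
    case empty
    then show ?case using B by simp
  next
    case (insert j E')
    have "rat_unit j \<notin> rat_vec.span (B \<union> rat_unit ` E')"
    proof
      assume "rat_unit j \<in> rat_vec.span (B \<union> rat_unit ` E')"
      then obtain x y where xy: "rat_unit j = x + y" "x \<in> rat_vec.span B" "y \<in> rat_vec.span (rat_unit ` E')"
        unfolding rat_vec.span_Un by blast
      have y: "Poly_Mapping.keys y \<subseteq> E'" by (rule span_rat_units_keys[OF xy(3)])
      have "x \<in> rat_vec.span (to_rat ` L)" using xy(2) rat_vec.span_mono[OF B(1)] by blast
      then obtain N u where N: "N \<noteq> 0" "u \<in> L" "Poly_Mapping.map ((*) (of_int N)) x = to_rat u"
        using span_clear_denominators by blast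
      have Nx: "of_int N * Poly_Mapping.lookup x i = (of_int (Poly_Mapping.lookup u i) :: rat)" for i
        using arg_cong[OF N(3), of "\<lambda>z. Poly_Mapping.lookup z i"] by (simp add: lookup_map_zero lookup_to_rat)
      \<comment> \<open>The part x from the span of L is supported in E because both e_j and y
        are.\<close>
      have "x = rat_unit j - y" using xy(1) by simp
      then have "Poly_Mapping.keys x \<subseteq> insert j E'"
        using keys_diff[of "rat_unit j" y] y by (auto simp: rat_unit_def)
      then have "Poly_Mapping.lookup x i = 0" if "i \<notin> E" for i
        using that insert.prems by (metis in_keys_iff subset_iff)
      then have "Poly_Mapping.lookup u i = 0" if "i \<notin> E" for i
        using Nx[of i] that by simp
      then have "Poly_Mapping.keys u \<subseteq> E" by (auto simp: in_keys_iff)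
      then have "u = 0" by (rule E(2)[OF N(2)])
      then have "x = 0" using Nx N(1) by (intro poly_mapping_eqI) simp
      then have "Poly_Mapping.keys (rat_unit j) \<subseteq> E'" using xy(1) y by simp
      then show False using insert.hyps by (simp add: rat_unit_def)
    qed
    then have "rat_vec.independent (insert (rat_unit j) (B \<union> rat_unit ` E'))"
      and "rat_unit j \<notin> B \<union> rat_unit ` E'"
      using insert rat_vec.independent_insertI[of "rat_unit j" "B \<union> rat_unit ` E'"]
        rat_vec.span_base[of "rat_unit j" "B \<union> rat_unit ` E'"]
      by auto
    moreover have "finite (B \<union> rat_unit ` E')" using B insert.hyps by simp
    ultimately show ?case
      using insert by (simp only: image_insert Un_insert_right card_insert_disjoint) auto
  qed
  have "finite E" by (rule finite_subset[OF E(1) finite_V])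
  from ind[OF this] have "rat_vec.independent (B \<union> rat_unit ` E)"
    "card (B \<union> rat_unit ` E) = rat_rank L + card E" by auto
  moreover have "B \<union> rat_unit ` E \<subseteq> rat_vec.span (rat_unit ` V)"
    using B(1) to_rat_L_span E(1) rat_vec.span_superset[of "rat_unit ` V"] by blast
  ultimately have "rat_rank L + card E \<le> card (rat_unit ` V)"
    using rat_vec.independent_span_bound[of "rat_unit ` V" "B \<union> rat_unit ` E"] finite_V by auto
  then show ?thesis using card_image[OF inj_rat_unit] by simp
qed

text \<open>E is maximal with L meeting its coordinate space only in 0. For j outside E some u in L
  is supported in E and j with nonzero entry at j, so L and the unit vectors of E together span
  every e_j.\<close>

lemma ex_complementary_coordinates:
  obtains E where "E \<subseteq> V" "\<And>u. u \<in> L \<Longrightarrow> Poly_Mapping.keys u \<subseteq> E \<Longrightarrow> u = 0"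
    "card V \<le> card E + rat_rank L"
proof -
  let ?A = "{E. E \<subseteq> V \<and> (\<forall>u\<in>L. Poly_Mapping.keys u \<subseteq> E \<longrightarrow> u = 0)}"
  have "finite ?A" using finite_V by simp
  moreover have "{} \<in> ?A" by auto
  ultimately have "\<exists>E\<in>?A. \<forall>E'\<in>?A. E \<subseteq> E' \<longrightarrow> E = E'"
    by (intro finite_has_maximal) blast+
  then obtain E where E: "E \<in> ?A" and "\<forall>E'\<in>?A. E \<subseteq> E' \<longrightarrow> E = E'"
    by (elim bexE)
  note max = mp[OF bspec[OF this(2)]]
  have "E \<subseteq> V" using E by simp
  then have finE: "finite E" by (rule finite_subset[OF _ finite_V])
  obtain B where B: "to_rat ` L \<subseteq> rat_vec.span B" "finite B" "card B = rat_rank L"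
    using basis by metis
  let ?S = "B \<union> rat_unit ` E"
  have "rat_unit j \<in> rat_vec.span ?S" if j: "j \<in> V" for j
  proof (cases "j \<in> E")
    case True
    then show ?thesis by (intro rat_vec.span_base) auto
  next
    case False
    then have "insert j E \<notin> ?A" using max[of "insert j E"] by blast
    then obtain u where u: "u \<in> L" "Poly_Mapping.keys u \<subseteq> insert j E" "u \<noteq> 0"
      using E j by blast
    let ?c = "of_int (Poly_Mapping.lookup u j) :: rat"
    have "j \<in> Poly_Mapping.keys u" using u E by auto
    then have c: "?c \<noteq> 0" by (simp add: in_keys_iff)
    have "to_rat u = (\<Sum>i\<in>insert j E. Poly_Mapping.map ((*) (Poly_Mapping.lookup (to_rat u) i)) (rat_unit i))"
      using finE u by (intro rat_expansion) (auto simp: keys_to_rat)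
    also have "\<dots> = Poly_Mapping.map ((*) ?c) (rat_unit j) +
        (\<Sum>i\<in>E. Poly_Mapping.map ((*) (Poly_Mapping.lookup (to_rat u) i)) (rat_unit i))"
      using finE False by (simp add: lookup_to_rat)
    finally have "Poly_Mapping.map ((*) ?c) (rat_unit j) =
        to_rat u - (\<Sum>i\<in>E. Poly_Mapping.map ((*) (Poly_Mapping.lookup (to_rat u) i)) (rat_unit i))"
      by (subst eq_diff_eq) (rule sym)
    also have "\<dots> \<in> rat_vec.span ?S"
    proof (intro rat_vec.span_diff rat_vec.span_sum rat_vec.span_scale)
      show "to_rat u \<in> rat_vec.span ?S"
        using u(1) B(1) rat_vec.span_mono[of B ?S] by blast
    qed (intro rat_vec.span_base, blast)
    finally have "Poly_Mapping.map ((*) (inverse ?c)) (Poly_Mapping.map ((*) ?c) (rat_unit j)) \<in> rat_vec.span ?S"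
      by (rule rat_vec.span_scale)
    then show ?thesis using c by simp
  qed
  then have "rat_unit ` V \<subseteq> rat_vec.span ?S" by blast
  then have "card (rat_unit ` V) \<le> card ?S"
    using rat_vec.independent_span_bound[of ?S] independent_rat_units finE B(2) by blast
  also have "\<dots> \<le> card B + card E"
    using card_Un_le[of B "rat_unit ` E"] card_image_le[OF finE, of rat_unit] by linarith
  finally have "card V \<le> card E + rat_rank L"
    using card_image[OF inj_rat_unit, of V] B(3) by simp
  then show thesis using that E by blast
qed

lemma rat_rank_le_card:
  assumes "finite U" "to_rat ` L \<subseteq> rat_vec.span (to_rat ` U)"
  shows "rat_rank L \<le> card U"
  unfolding rat_rank_def
  using rat_vec.dim_le_card[OF assms(2)] card_image_le[OF assms(1), of to_rat] assms(1) by simp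

lemma card_le_rat_rank:
  assumes "U \<subseteq> L" "rat_vec.independent (to_rat ` U)" "inj_on to_rat U"
  shows "card U \<le> rat_rank L"
proof -
  obtain B where B: "to_rat ` L \<subseteq> rat_vec.span B" "finite B" "card B = rat_rank L"
    using basis by metis
  have "to_rat ` U \<subseteq> rat_vec.span B" using assms(1) B(1) by blast
  then have "card (to_rat ` U) \<le> card B"
    using rat_vec.independent_span_bound[OF B(2) assms(2)] by blast
  then show ?thesis using B(3) card_image[OF assms(3)] by simp
qed

text \<open>A basis chosen inside the image of U has at least \<open>rat_rank L\<close> elements, so
  the cardinalities of this basis, of the image and of U are squeezed to equality.\<close>

lemma independent_if_minimal_spanning:
  assumes "finite U" "card U \<le> rat_rank L" "U \<subseteq> L" "to_rat ` L \<subseteq> rat_vec.span (to_rat ` U)"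
  shows "rat_vec.independent (to_rat ` U)" "inj_on to_rat U"
proof -
  obtain B where B: "B \<subseteq> to_rat ` U" "rat_vec.independent B" "to_rat ` U \<subseteq> rat_vec.span B"
    using rat_vec.maximal_independent_subset by metis
  have fin: "finite B" using B(1) assms(1) by (rule finite_subset[OF _ finite_imageI])
  have "to_rat ` L \<subseteq> rat_vec.span B"
    using assms(4) rat_vec.span_minimal[OF B(3) rat_vec.subspace_span] by blast
  then have "rat_rank L \<le> card B"
    unfolding rat_rank_def using fin by (rule rat_vec.dim_le_card)
  moreover have "card B \<le> card (to_rat ` U)" using B(1) assms(1) by (intro card_mono) auto
  moreover have "card (to_rat ` U) \<le> card U" by (rule card_image_le[OF assms(1)])
  ultimately have eq: "card B = card (to_rat ` U)" "card (to_rat ` U) = card U"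
    using assms(2) by auto
  show "inj_on to_rat U" by (rule eq_card_imp_inj_on[OF assms(1) eq(2)])
  have "B = to_rat ` U" using B(1) eq(1) assms(1) by (intro card_subset_eq) auto
  then show "rat_vec.independent (to_rat ` U)" using B(2) by simp
qed

end

section \<open>Lattice ideals\<close>

lemma lookup_pos_part: "Poly_Mapping.lookup (pos_part u) i = nat (Poly_Mapping.lookup u i)"
  by (simp add: pos_part_def lookup_map_zero)

text \<open>Exponents as integer vectors: monomials are in the same fiber when their difference here
  lies in L.\<close>

definition int_vec :: "(nat \<Rightarrow>\<^sub>0 nat) \<Rightarrow> (nat \<Rightarrow>\<^sub>0 int)" where
  "int_vec t = Poly_Mapping.map int t"

lemma lookup_int_vec: "Poly_Mapping.lookup (int_vec t) i = int (Poly_Mapping.lookup t i)"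
  by (simp add: int_vec_def lookup_map_zero)

lemma int_vec_add: "int_vec (s + t) = int_vec s + int_vec t"
  by (rule poly_mapping_eqI) (simp add: lookup_int_vec lookup_add)

lemma int_vec_eq_iff: "int_vec s = int_vec t \<longleftrightarrow> s = t"
  by (metis lookup_int_vec of_nat_eq_iff poly_mapping_eqI)

lemma keys_int_vec: "Poly_Mapping.keys (int_vec t) = Poly_Mapping.keys t"
  by (auto simp: in_keys_iff lookup_int_vec)

lemma int_vec_pos_part: "int_vec (pos_part u) - int_vec (pos_part (- u)) = u"
  by (rule poly_mapping_eqI) (simp add: lookup_int_vec lookup_pos_part lookup_minus)

lemma keys_pos_part: "Poly_Mapping.keys u = Poly_Mapping.keys (pos_part u) \<union> Poly_Mapping.keys (pos_part (- u))"
  by (auto simp: in_keys_iff lookup_pos_part)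

lemma lookup_single_0_times: "Poly_Mapping.lookup (Poly_Mapping.single 0 c * p) t = c * Poly_Mapping.lookup p t"
  for p :: "(nat \<Rightarrow>\<^sub>0 nat) \<Rightarrow>\<^sub>0 'k::field"
  by (simp add: lookup_map_zero flip: mult_map_scale_conv_mult)

section \<open>Linear functionals and projections onto sets of monomials\<close>

definition lin_ext :: "('a \<Rightarrow> 'k) \<Rightarrow> ('a \<Rightarrow>\<^sub>0 'k::field) \<Rightarrow> 'k" where
  "lin_ext h f = (\<Sum>t\<in>Poly_Mapping.keys f. Poly_Mapping.lookup f t * h t)"

lemma lin_ext_add: "lin_ext h (f + g) = lin_ext h f + lin_ext h g"
  unfolding lin_ext_def by (rule setsum_keys_plus_distrib) (simp_all add: algebra_simps)

lemma lin_ext_single: "lin_ext h (Poly_Mapping.single t c) = c * h t"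
  by (cases "c = 0") (simp_all add: lin_ext_def)

lemma lin_ext_diff: "lin_ext h (f - g) = lin_ext h f - lin_ext h g"
  using lin_ext_add[of h "f - g" g] by simp

lemma lin_ext_scale:
  fixes f :: "(nat \<Rightarrow>\<^sub>0 nat) \<Rightarrow>\<^sub>0 'k::field"
  shows "lin_ext h (Poly_Mapping.single 0 c * f) = c * lin_ext h f"
proof (induction f rule: poly_mapping_induct_single)
  case (add t d q)
  then show ?case by (simp add: distrib_left lin_ext_add lin_ext_single mult_single)
qed (simp add: lin_ext_def)

lemma lin_ext_subspace:
  "poly.subspace {f :: (nat \<Rightarrow>\<^sub>0 nat) \<Rightarrow>\<^sub>0 'k::field. lin_ext h f = 0}"
  by (rule poly.subspaceI) (auto simp: lin_ext_add lin_ext_scale, simp add: lin_ext_def)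

text \<open>On polynomials this is a projection. With A the exponents supported in W it substitutes
  0 for the variables outside W; with A a coset of L it takes a graded component.\<close>

definition restr :: "'a set \<Rightarrow> ('a \<Rightarrow>\<^sub>0 'b::zero) \<Rightarrow> ('a \<Rightarrow>\<^sub>0 'b)" where
  "restr A = Poly_Mapping.mapp (\<lambda>t c. if t \<in> A then c else 0)"

lemma lookup_restr: "Poly_Mapping.lookup (restr A p) t = (if t \<in> A then Poly_Mapping.lookup p t else 0)"
  by (auto simp: restr_def lookup_mapp when_def in_keys_iff)

text \<open>The projection is linear, so a spanning set is all that has to be checked.\<close>

lemma restr_in_subspace:
  fixes J :: "((nat \<Rightarrow>\<^sub>0 nat) \<Rightarrow>\<^sub>0 'k::field) set"
  assumes "poly.subspace J" "\<And>f. f \<in> S \<Longrightarrow> restr A f \<in> J" "f \<in> poly.span S"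
  shows "restr A f \<in> J"
proof -
  have "poly.subspace {f. restr A f \<in> J}"
  proof (rule poly.subspaceI)
    have "restr A 0 = (0 :: (nat \<Rightarrow>\<^sub>0 nat) \<Rightarrow>\<^sub>0 'k)"
      by (rule poly_mapping_eqI) (simp add: lookup_restr)
    then show "0 \<in> {f. restr A f \<in> J}" using poly.subspace_0[OF assms(1)] by simp
  next
    fix f g assume "f \<in> {f. restr A f \<in> J}" "g \<in> {f. restr A f \<in> J}"
    moreover have "restr A (f + g) = restr A f + restr A g"
      by (rule poly_mapping_eqI) (simp add: lookup_restr lookup_add)
    ultimately show "f + g \<in> {f. restr A f \<in> J}" using poly.subspace_add[OF assms(1)] by simp
  next
    fix c f assume "f \<in> {f. restr A f \<in> J}"
    moreover have "restr A (Poly_Mapping.single 0 c * f) = Poly_Mapping.single 0 c * restr A f"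
      by (rule poly_mapping_eqI) (simp add: lookup_restr lookup_single_0_times)
    ultimately show "Poly_Mapping.single 0 c * f \<in> {f. restr A f \<in> J}"
      using poly.subspace_scale[OF assms(1)] by simp
  qed
  then have "poly.span S \<subseteq> {f. restr A f \<in> J}"
    using assms(2) by (intro poly.span_minimal) auto
  then show ?thesis using assms(3) by blast
qed

lemma monomial_times_binomial:
  "Poly_Mapping.single t c * lattice_binomial \<rho> v =
     Poly_Mapping.single (t + pos_part v) c - Poly_Mapping.single (t + pos_part (- v)) (c * \<rho> v)"
  by (simp add: lattice_binomial_def right_diff_distrib mult_single)

lemma restr_binomial:
  assumes "t + pos_part v \<in> A \<longleftrightarrow> t + pos_part (- v) \<in> A"
  shows "restr A (Poly_Mapping.single t c * lattice_binomial \<rho> v) =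
    (if t + pos_part v \<in> A then Poly_Mapping.single t c * lattice_binomial \<rho> v else 0)"
  unfolding monomial_times_binomial using assms
  by (intro poly_mapping_eqI) (auto simp: lookup_restr lookup_minus lookup_single when_def)

lemma restr_binomial_1:
  assumes "pos_part v \<in> A" "pos_part (- v) \<in> A"
  shows "restr A (lattice_binomial \<rho> v) = lattice_binomial \<rho> v"
  using restr_binomial[of 0 v A 1 \<rho>] assms by simp

lemma binomial_polys: "Poly_Mapping.keys u \<subseteq> V \<Longrightarrow> lattice_binomial \<rho> u \<in> polys V"
  unfolding lattice_binomial_def using keys_pos_part[of u] by (intro polys_diff) auto

text \<open>The map \<rho> is total with only its values on L constrained, so one map serves L and
  its sublattices.\<close>

locale lattice_character = lattice V L for V L +
  fixes \<rho> :: "(nat \<Rightarrow>\<^sub>0 int) \<Rightarrow> 'k::field"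
  assumes rho_0: "\<rho> 0 = 1"
    and rho_add: "u \<in> L \<Longrightarrow> v \<in> L \<Longrightarrow> \<rho> (u + v) = \<rho> u * \<rho> v"
begin

abbreviation "binom \<equiv> lattice_binomial \<rho>"

lemma rho_nonzero: "u \<in> L \<Longrightarrow> \<rho> u \<noteq> 0"
  using rho_add[OF _ L_uminus, of u u] rho_0 by auto

lemma binomials_polys: "U \<subseteq> L \<Longrightarrow> binom ` U \<subseteq> polys V"
  using L_keys binomial_polys by blast

lemma poly_ideal_lattice_ideal: "poly_ideal V (lattice_ideal V L \<rho>)"
  unfolding lattice_ideal_def by (rule poly_ideal_Idl[OF binomials_polys]) simp

lemma binomial_in_lattice_ideal: "u \<in> L \<Longrightarrow> binom u \<in> lattice_ideal V L \<rho>"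
  unfolding lattice_ideal_def using Idl_superset[OF binomials_polys[of L]] by blast

lemma lattice_ideal_eq_span:
  "lattice_ideal V L \<rho> =
    poly.span {Poly_Mapping.single t 1 * binom v | t v. Poly_Mapping.keys t \<subseteq> V \<and> v \<in> L}"
  unfolding lattice_ideal_def Idl_eq_span[OF binomials_polys[OF order_refl]]
  by (rule arg_cong[where f = poly.span]) blast

text \<open>A linear functional that evaluates the part of degree \<open>t0 + L\<close> at a point of the torus on
  which every \<open>x\<^sup>u\<close> with \<open>u \<in> L\<close> takes the value \<open>\<rho> u\<close>.\<close>

definition coset_weight :: "(nat \<Rightarrow>\<^sub>0 nat) \<Rightarrow> (nat \<Rightarrow>\<^sub>0 nat) \<Rightarrow> 'k" where
  "coset_weight t0 t = (if int_vec t - int_vec t0 \<in> L then \<rho> (int_vec t - int_vec t0) else 0)"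

text \<open>The two exponents of x^t B(v) differ by v, hence lie in one coset of L, and their
  weights differ by the factor \<rho> v. So the functional vanishes on each spanning
  element.\<close>

lemma lin_ext_coset_weight:
  assumes "f \<in> lattice_ideal V L \<rho>"
  shows "lin_ext (coset_weight t0) f = 0"
proof -
  have "lin_ext (coset_weight t0) (Poly_Mapping.single t 1 * binom v) = 0" if v: "v \<in> L" for t v
  proof -
    let ?a = "int_vec (t + pos_part v) - int_vec t0" and ?b = "int_vec (t + pos_part (- v)) - int_vec t0"
    have ab: "?a = ?b + v"
      using int_vec_pos_part[of v] by (simp add: int_vec_add algebra_simps)
    have "?a \<in> L \<longleftrightarrow> ?b \<in> L"
      using L_add[of ?b v] L_diff[of ?a v] v unfolding ab by auto
    moreover have "?b \<in> L \<Longrightarrow> \<rho> ?a = \<rho> ?b * \<rho> v"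
      unfolding ab by (rule rho_add[OF _ v])
    ultimately have "coset_weight t0 (t + pos_part v) = \<rho> v * coset_weight t0 (t + pos_part (- v))"
      unfolding coset_weight_def by auto
    then show ?thesis
      unfolding monomial_times_binomial lin_ext_diff lin_ext_single by simp
  qed
  then have "lattice_ideal V L \<rho> \<subseteq> {f. lin_ext (coset_weight t0) f = 0}"
    unfolding lattice_ideal_eq_span by (intro poly.span_minimal lin_ext_subspace) auto
  then show ?thesis using assms by blast
qed

text \<open>Distinct exponents supported in E lie in distinct cosets of L, so the functional at t0
  reads off the coefficient of t0.\<close>

lemma lattice_ideal_inter_polys:
  assumes E: "\<And>u. u \<in> L \<Longrightarrow> Poly_Mapping.keys u \<subseteq> E \<Longrightarrow> u = 0"
  shows "lattice_ideal V L \<rho> \<inter> polys E \<subseteq> {0}"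
proof
  fix f assume f: "f \<in> lattice_ideal V L \<rho> \<inter> polys E"
  have "t0 \<notin> Poly_Mapping.keys f" for t0
  proof
    assume t0: "t0 \<in> Poly_Mapping.keys f"
    have "coset_weight t0 t = (if t = t0 then 1 else 0)" if t: "t \<in> Poly_Mapping.keys f" for t
    proof -
      have "Poly_Mapping.keys (int_vec t - int_vec t0) \<subseteq> E"
        using keys_diff[of "int_vec t" "int_vec t0"] f t t0 by (auto simp: keys_int_vec polys_def)
      then have "int_vec t - int_vec t0 \<in> L \<Longrightarrow> t = t0"
        using E[of "int_vec t - int_vec t0"] int_vec_eq_iff by simp
      then show ?thesis by (auto simp: coset_weight_def L_0 rho_0)
    qed
    then have "lin_ext (coset_weight t0) f = (\<Sum>t\<in>Poly_Mapping.keys f. if t = t0 then Poly_Mapping.lookup f t else 0)"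
      unfolding lin_ext_def by (intro sum.cong) auto
    also have "\<dots> = Poly_Mapping.lookup f t0" using t0 by simp
    finally show False using lin_ext_coset_weight[of f t0] f t0 by (simp add: in_keys_iff)
  qed
  then have "Poly_Mapping.keys f = {}" by blast
  then show "f \<in> {0}" by simp
qed

text \<open>If u were outside L, the functional based at the exponent of the second term would see
  that term alone.\<close>

lemma binomial_in_lattice_idealD:
  assumes "Poly_Mapping.single (pos_part u) 1 - Poly_Mapping.single (pos_part (- u)) c \<in> lattice_ideal V L \<rho>"
    "c \<noteq> 0"
  shows "u \<in> L"
proof (rule ccontr)
  assume u: "u \<notin> L"
  have "lin_ext (coset_weight (pos_part (- u)))
      (Poly_Mapping.single (pos_part u) 1 - Poly_Mapping.single (pos_part (- u)) c) = - c"
    using u by (simp add: lin_ext_diff lin_ext_single coset_weight_def int_vec_pos_part L_0 rho_0)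
  then show False using lin_ext_coset_weight[OF assms(1)] assms(2) by simp
qed

lemma binomial_nonzero:
  assumes "u \<in> L" "u \<noteq> 0"
  shows "binom u \<noteq> 0"
proof
  assume "binom u = 0"
  then have "Poly_Mapping.single (pos_part u) 1 = Poly_Mapping.single (pos_part (- u)) (\<rho> u)"
    by (simp add: lattice_binomial_def)
  from arg_cong[OF this, of Poly_Mapping.keys] have "pos_part u = pos_part (- u)"
    using rho_nonzero[OF assms(1)] by simp
  then show False using int_vec_pos_part[of u] assms(2) by simp
qed

subsection \<open>The height of a lattice ideal\<close>

lemma ideal_height_lattice_ideal:
  "ideal_height (mpoly_ring V) (lattice_ideal V L \<rho>) = enat (rat_rank L)" (is "?h = _")
proof (rule antisym)
  obtain E where E: "E \<subseteq> V" "\<And>u. u \<in> L \<Longrightarrow> Poly_Mapping.keys u \<subseteq> E \<Longrightarrow> u = 0"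
    "card V \<le> card E + rat_rank L"
    by (rule ex_complementary_coordinates) blast
  \<comment> \<open>The nonzero polynomials in the variables of E are closed under products, so a
    prime over the lattice ideal can avoid them.\<close>
  have "lattice_ideal V L \<rho> \<inter> (polys E - {0}) = {}"
    using lattice_ideal_inter_polys[OF E(2)] by blast
  then obtain P where P: "poly_prime V P" "lattice_ideal V L \<rho> \<subseteq> P" "P \<inter> (polys E - {0}) = {}"
    using polys_mono[OF E(1)]
    by (rule_tac ex_prime_avoiding[OF poly_ideal_lattice_ideal, of "polys E - {0}"]) auto
  have "prime_height (mpoly_ring V) P \<le> enat (rat_rank L)"
    unfolding prime_height_def
  proof (rule SUP_least)
    fix k assume "k \<in> {k. \<exists>C. (\<forall>i\<le>k. primeideal (C i) (mpoly_ring V)) \<and> (\<forall>i<k. C i \<subset> C (Suc i)) \<and> C k = P}"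
    then obtain C where C: "\<forall>i\<le>k. poly_prime V (C i)" "\<forall>i<k. C i \<subset> C (Suc i)" "C k = P"
      by (auto simp: primeideal_mpoly_ring_iff)
    have "card E + k \<le> card V"
      by (rule prime_chain_length_le[OF finite_V E(1), where C = C]) (use C P(3) in auto)
    then show "enat k \<le> enat (rat_rank L)" using E(3) by simp
  qed
  moreover have "?h \<le> prime_height (mpoly_ring V) P"
    unfolding ideal_height_def using P by (intro INF_lower) (auto simp: primeideal_mpoly_ring_iff)
  ultimately show "?h \<le> enat (rat_rank L)" by (rule order_trans[rotated])
next
  show "enat (rat_rank L) \<le> ?h"
    unfolding ideal_height_def
  proof (rule INF_greatest)
    fix P assume "P \<in> {P. primeideal P (mpoly_ring V) \<and> lattice_ideal V L \<rho> \<subseteq> P}"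
    then have P: "poly_prime V P" "lattice_ideal V L \<rho> \<subseteq> P"
      by (auto simp: primeideal_mpoly_ring_iff)
    obtain C k E where C: "\<forall>i\<le>k. poly_prime V (C i)" "\<forall>i<k. C i \<subset> C (Suc i)" "C k = P"
      and E: "E \<subseteq> V" "P \<inter> polys E \<subseteq> {0}" "card V \<le> card E + k"
      using ex_prime_chain[OF finite_V P(1)] by (elim exE conjE) (rule that)
    \<comment> \<open>A nonzero u would put the nonzero binomial B(u) into both P and
      \<open>polys E\<close>.\<close>
    have "u = 0" if u: "u \<in> L" "Poly_Mapping.keys u \<subseteq> E" for u
    proof -
      have "binom u \<in> P \<inter> polys E"
        using u P(2) binomial_in_lattice_ideal binomial_polys by blast
      then show ?thesis using E(2) binomial_nonzero[OF u(1)] by blast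
    qed
    then have "card E + rat_rank L \<le> card V" by (rule card_plus_rank_le[OF E(1)])
    then have "enat (rat_rank L) \<le> enat k" using E(3) by simp
    also have "enat k \<le> prime_height (mpoly_ring V) P"
      unfolding prime_height_def
      using C by (intro SUP_upper) (auto simp: primeideal_mpoly_ring_iff)
    finally show "enat (rat_rank L) \<le> prime_height (mpoly_ring V) P" .
  qed
qed

subsection \<open>Binomial generating sets\<close>

text \<open>The vectors of L in the rational span of U form a sublattice whose ideal contains the
  generators, hence every B(u) with u in L; by \<open>binomial_in_lattice_idealD\<close> such a u
  belongs to the sublattice.\<close>

lemma span_of_binomial_generators:
  assumes "U \<subseteq> L" "Idl\<^bsub>mpoly_ring V\<^esub> (binom ` U) = lattice_ideal V L \<rho>"
  shows "to_rat ` L \<subseteq> rat_vec.span (to_rat ` U)"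
proof -
  let ?L = "{u \<in> L. to_rat u \<in> rat_vec.span (to_rat ` U)}"
  have to_rat_add: "to_rat (u + v) = to_rat u + to_rat v" and to_rat_uminus: "to_rat (- u) = - to_rat u"
    and to_rat_0: "to_rat 0 = 0" for u v
    by (auto intro!: poly_mapping_eqI simp: lookup_to_rat lookup_add)
  interpret sub: lattice_character V ?L \<rho>
    by unfold_locales
      (auto simp: finite_V L_0 L_add L_uminus rho_0 rho_add to_rat_add to_rat_uminus to_rat_0
        intro: rat_vec.span_add rat_vec.span_neg rat_vec.span_zero dest: L_keys)
  have "U \<subseteq> ?L" using assms(1) rat_vec.span_superset[of "to_rat ` U"] by blast
  then have sub: "lattice_ideal V L \<rho> \<subseteq> lattice_ideal V ?L \<rho>"
    unfolding assms(2)[symmetric]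
    by (intro Idl_least[OF sub.poly_ideal_lattice_ideal]) (auto intro: sub.binomial_in_lattice_ideal)
  have "u \<in> ?L" if "u \<in> L" for u
    using that sub binomial_in_lattice_ideal[of u] rho_nonzero
    by (intro sub.binomial_in_lattice_idealD[of u "\<rho> u"]) (auto simp: lattice_binomial_def)
  then show ?thesis by blast
qed

end

subsection \<open>Dickson's lemma and the size of fibers\<close>

text \<open>A monotone subsequence exists, and a decreasing one in the naturals is constant once it
  attains its minimum.\<close>

lemma nat_seq_mono_subseq:
  fixes g :: "nat \<Rightarrow> nat"
  obtains s :: "nat \<Rightarrow> nat" where "strict_mono s" "mono (g \<circ> s)"
proof -
  obtain s :: "nat \<Rightarrow> nat" where s: "strict_mono s" "monoseq (\<lambda>n. g (s n))"
    using seq_monosub[of g] by blast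
  show thesis
  proof (cases "incseq (\<lambda>n. g (s n))")
    case True
    then show ?thesis using that[OF s(1)] by (simp add: comp_def)
  next
    case False
    then have dec: "decseq (\<lambda>n. g (s n))" using s(2) by (simp add: monoseq_iff)
    define N where "N = (ARG_MIN (\<lambda>n. g (s n)) n. True)"
    have "g (s N) \<le> g (s n)" for n
      unfolding N_def by (rule arg_min_nat_le) simp
    then have "g (s (n + N)) = g (s N)" for n
      using decseqD[OF dec, of N "n + N"] by (simp add: antisym)
    moreover have "strict_mono (\<lambda>n. s (n + N))"
      using s(1) by (auto simp: strict_mono_def)
    ultimately show ?thesis by (intro that[of "\<lambda>n. s (n + N)"]) (auto simp: mono_def)
  qed
qed

lemma dickson_subseq:
  fixes f :: "nat \<Rightarrow> (nat \<Rightarrow>\<^sub>0 nat)"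
  assumes "finite V"
  shows "\<exists>s :: nat \<Rightarrow> nat. strict_mono s \<and> (\<forall>k\<in>V. mono (\<lambda>n. Poly_Mapping.lookup (f (s n)) k))"
  using assms
proof (induction V rule: finite_induct)
  case empty
  show ?case by (intro exI[of _ id]) (auto simp: strict_mono_def)
next
  case (insert j V)
  then obtain s :: "nat \<Rightarrow> nat" where s: "strict_mono s"
    "\<forall>k\<in>V. mono (\<lambda>n. Poly_Mapping.lookup (f (s n)) k)"
    by blast
  obtain r :: "nat \<Rightarrow> nat" where r: "strict_mono r" "mono ((\<lambda>n. Poly_Mapping.lookup (f (s n)) j) \<circ> r)"
    by (rule nat_seq_mono_subseq[of "\<lambda>n. Poly_Mapping.lookup (f (s n)) j"])
  have "mono (\<lambda>n. Poly_Mapping.lookup (f (s (r n))) k)" if "k \<in> V" for k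
    using s(2) that strict_mono_mono[OF r(1)] by (auto simp: mono_def)
  then show ?case
    using r s(1) by (intro exI[of _ "s \<circ> r"]) (auto simp: comp_def strict_mono_def)
qed

text \<open>By Dickson's lemma an infinite fiber has two distinct comparable exponents; their
  difference is a nonzero nonnegative vector of L.\<close>

lemma (in lattice) finite_fiber:
  assumes pos: "positive_lattice L"
  shows "finite {s. Poly_Mapping.keys s \<subseteq> V \<and> int_vec s - int_vec t \<in> L}" (is "finite ?F")
proof (rule ccontr)
  assume "infinite ?F"
  then obtain f :: "nat \<Rightarrow> (nat \<Rightarrow>\<^sub>0 nat)" where f: "inj f" "range f \<subseteq> ?F"
    using infinite_countable_subset[of ?F] by blast
  obtain r :: "nat \<Rightarrow> nat" where r: "strict_mono r"
    "\<forall>k\<in>V. mono (\<lambda>n. Poly_Mapping.lookup (f (r n)) k)"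
    using dickson_subseq[OF finite_V, of f] by blast
  let ?s = "f (r 0)" and ?t = "f (r 1)"
  have st: "?s \<in> ?F" "?t \<in> ?F" using f(2) by auto
  have "(int_vec ?t - int_vec t) - (int_vec ?s - int_vec t) \<in> L"
    using st by (intro L_diff[of "int_vec ?t - int_vec t" "int_vec ?s - int_vec t"]) simp_all
  then have d: "int_vec ?t - int_vec ?s \<in> L" by simp
  have "0 \<le> Poly_Mapping.lookup (int_vec ?t - int_vec ?s) k" for k
  proof (cases "k \<in> V")
    case True
    then have "Poly_Mapping.lookup ?s k \<le> Poly_Mapping.lookup ?t k"
      using r(2) by (auto simp: mono_def)
    then show ?thesis by (simp add: lookup_minus lookup_int_vec)
  next
    case False
    then have "k \<notin> Poly_Mapping.keys ?s" "k \<notin> Poly_Mapping.keys ?t" using st by auto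
    then show ?thesis by (simp add: lookup_minus lookup_int_vec in_keys_iff)
  qed
  then have "int_vec ?t - int_vec ?s = 0"
    using d pos unfolding positive_lattice_def by blast
  then have "r 1 = r 0"
    using f(1) int_vec_eq_iff by (auto dest: injD)
  then show False using strict_monoD[OF r(1), of 0 1] by simp
qed

text \<open>The largest total degree of a monomial in the same fiber. Unlike the total degree itself it
  is constant on fibers, so it replaces a positive grading.\<close>

definition (in lattice) fiber_size :: "(nat \<Rightarrow>\<^sub>0 nat) \<Rightarrow> nat" where
  "fiber_size t = Max ((\<lambda>s. \<Sum>i\<in>V. Poly_Mapping.lookup s i) `
     {s. Poly_Mapping.keys s \<subseteq> V \<and> int_vec s - int_vec t \<in> L})"

text \<open>Adding a to an exponent of largest degree in the fiber of p lands in the fiber of t with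
  strictly larger degree.\<close>

lemma (in lattice) fiber_size_less:
  assumes pos: "positive_lattice L" and a: "Poly_Mapping.keys a \<subseteq> V" "a \<noteq> 0"
    and p: "Poly_Mapping.keys p \<subseteq> V" and t: "int_vec (a + p) - int_vec t \<in> L"
  shows "fiber_size p < fiber_size t"
proof -
  let ?F = "\<lambda>t. {s. Poly_Mapping.keys s \<subseteq> V \<and> int_vec s - int_vec t \<in> L}"
  let ?d = "\<lambda>s. \<Sum>i\<in>V. Poly_Mapping.lookup s i"
  have "p \<in> ?F p" using p L_0 by simp
  then have "fiber_size p \<in> ?d ` ?F p"
    unfolding fiber_size_def by (intro Max_in finite_imageI finite_fiber[OF pos]) blast
  then obtain s where s: "s \<in> ?F p" "fiber_size p = ?d s" by blast
  have "(int_vec s - int_vec p) + (int_vec (a + p) - int_vec t) \<in> L"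
    using s t by (intro L_add) auto
  then have "int_vec (a + s) - int_vec t \<in> L"
    by (simp add: int_vec_add algebra_simps)
  then have "a + s \<in> ?F t" using a s by (simp add: keys_plus_nat)
  then have "?d (a + s) \<le> fiber_size t"
    unfolding fiber_size_def by (intro Max_ge finite_imageI finite_fiber[OF pos] imageI)
  moreover have "?d a > 0"
  proof -
    obtain i where "i \<in> Poly_Mapping.keys a" using a(2) by (metis all_not_in_conv keys_eq_empty)
    then have i: "i \<in> V" "Poly_Mapping.lookup a i > 0" using a(1) by (auto simp: in_keys_iff)
    then show ?thesis using member_le_sum[of i V "Poly_Mapping.lookup a"] finite_V by simp
  qed
  ultimately show ?thesis using s(2) by (simp add: lookup_add sum.distrib)
qed

subsection \<open>A graded Nakayama lemma\<close>

context vector_space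
begin

lemma span_finite_subset:
  assumes "x \<in> span S"
  shows "\<exists>T. finite T \<and> T \<subseteq> S \<and> x \<in> span T"
  using assms
proof (induction rule: span_induct_alt)
  case base
  show ?case by (intro exI[of _ "{}"]) simp
next
  case (step c x y)
  then obtain T where T: "finite T" "T \<subseteq> S" "y \<in> span T" by blast
  have "x \<in> span (insert x T)" "y \<in> span (insert x T)"
    using T(3) span_mono[of T "insert x T"] by (auto intro: span_base)
  then have "scale c x + y \<in> span (insert x T)" by (intro span_add span_scale)
  then show ?case using T step by (intro exI[of _ "insert x T"]) auto
qed

lemma span_finite_subset_set:
  assumes "finite W" "W \<subseteq> span S"
  shows "\<exists>T. finite T \<and> T \<subseteq> S \<and> W \<subseteq> span T"
  using assms
proof (induction rule: finite_induct)
  case empty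
  show ?case by (intro exI[of _ "{}"]) simp
next
  case (insert x W)
  then obtain T T' where T: "finite T" "T \<subseteq> S" "W \<subseteq> span T" and T': "finite T'" "T' \<subseteq> S" "x \<in> span T'"
    using span_finite_subset[of x S] by blast
  have "insert x W \<subseteq> span (T \<union> T')"
    using T(3) T'(3) span_mono[of T "T \<union> T'"] span_mono[of T' "T \<union> T'"] by blast
  then show ?case using T T' by (intro exI[of _ "T \<union> T'"]) auto
qed

text \<open>A basis N of the span of M is extended by elements of B. The added elements are
  independent modulo M, and exchange against G bounds their number although M may be
  infinite.\<close>

lemma steinitz_modulo:
  assumes G: "finite G" and B: "B \<subseteq> span (G \<union> M)"
  obtains W where "W \<subseteq> B" "finite W" "card W \<le> card G" "B \<subseteq> span (W \<union> M)"
proof -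
  obtain N where N: "N \<subseteq> M" "independent N" "M \<subseteq> span N"
    by (rule maximal_independent_subset)
  obtain D where D: "N \<subseteq> D" "D \<subseteq> N \<union> B" "independent D" "N \<union> B \<subseteq> span D"
    by (rule maximal_independent_subset_extend[of N "N \<union> B"]) (use N(2) in auto)
  \<comment> \<open>Finitely many elements of N suffice to express W together with G; they join both
    sides of the exchange and cancel in the count.\<close>
  have bound: "card W \<le> card G" if W: "finite W" "W \<subseteq> D - N" for W
  proof -
    have "G \<union> M \<subseteq> span (G \<union> N)"
      using N(3) span_mono[of N "G \<union> N"] span_superset[of "G \<union> N"] by blast
    then have "span (G \<union> M) \<subseteq> span (G \<union> N)" by (rule span_minimal) simp
    then have "W \<subseteq> span (G \<union> N)" using W(2) D(2) B by blast
    from span_finite_subset_set[OF W(1) this]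
    obtain T where T: "finite T" "T \<subseteq> G \<union> N" "W \<subseteq> span T" by (elim exE conjE)
    let ?T = "G \<union> (T \<inter> N)"
    have "W \<union> (T \<inter> N) \<subseteq> span ?T"
      using T span_mono[of T ?T] span_superset[of ?T] by blast
    moreover have "independent (W \<union> (T \<inter> N))"
      using W(2) D(1) by (intro independent_mono[OF D(3)]) auto
    ultimately have "card (W \<union> (T \<inter> N)) \<le> card ?T"
      using independent_span_bound[of ?T "W \<union> (T \<inter> N)"] G T(1) by simp
    also have "\<dots> \<le> card G + card (T \<inter> N)" by (rule card_Un_le)
    finally show ?thesis
      using W T(1) by (subst (asm) card_Un_disjoint) auto
  qed
  have fin: "finite (D - N)"
  proof (rule ccontr)
    assume "infinite (D - N)"
    from infinite_arbitrarily_large[OF this, of "Suc (card G)"]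
    obtain W where "finite W" "W \<subseteq> D - N" "card W = Suc (card G)" by (elim exE conjE)
    then show False using bound[of W] by simp
  qed
  have "D \<subseteq> (D - N) \<union> M" using N(1) by blast
  then have "B \<subseteq> span ((D - N) \<union> M)" using D(4) span_mono[of D "(D - N) \<union> M"] by blast
  moreover have "D - N \<subseteq> B" using D(2) by blast
  ultimately show thesis using fin bound[OF fin order_refl] by (intro that[of "D - N"])
qed

end

context lattice_character
begin

text \<open>Their span is the product of the lattice ideal with the ideal generated by the
  variables.\<close>

definition proper_multiples :: "((nat \<Rightarrow>\<^sub>0 nat) \<Rightarrow>\<^sub>0 'k) set" where
  "proper_multiples =
     {Poly_Mapping.single t 1 * binom v | t v. Poly_Mapping.keys t \<subseteq> V \<and> t \<noteq> 0 \<and> v \<in> L}"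

text \<open>Among the multiples x^t f of a generator f, all with t nonzero lie in the span of the
  proper multiples.\<close>

lemma generators_span_modulo:
  assumes G: "G \<subseteq> polys V" "Idl\<^bsub>mpoly_ring V\<^esub> G = lattice_ideal V L \<rho>"
  shows "lattice_ideal V L \<rho> \<subseteq> poly.span (G \<union> proper_multiples)"
proof -
  have mult: "Poly_Mapping.single t 1 * f \<in> poly.span proper_multiples"
    if t: "Poly_Mapping.keys t \<subseteq> V" "t \<noteq> 0" and f: "f \<in> lattice_ideal V L \<rho>" for t f
    using f unfolding lattice_ideal_eq_span
  proof (induction rule: poly.span_induct_alt)
    case base
    then show ?case by (simp add: poly.span_zero)
  next
    case (step c x y)
    then obtain s v where x: "x = Poly_Mapping.single s 1 * binom v" "Poly_Mapping.keys s \<subseteq> V" "v \<in> L"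
      by blast
    have "t + s \<noteq> 0"
      using t(2) keys_plus_nat[of t s] by (metis Un_empty keys_eq_empty keys_zero)
    moreover have "Poly_Mapping.keys (t + s) \<subseteq> V" using x t by (simp add: keys_plus_nat)
    ultimately have "Poly_Mapping.single (t + s) 1 * binom v \<in> proper_multiples"
      using x(3) unfolding proper_multiples_def by blast
    then have "Poly_Mapping.single 0 c * (Poly_Mapping.single (t + s) 1 * binom v) \<in> poly.span proper_multiples"
      by (intro poly.span_scale poly.span_base)
    moreover have "Poly_Mapping.single t 1 * (Poly_Mapping.single 0 c * x) =
        Poly_Mapping.single 0 c * (Poly_Mapping.single (t + s) 1 * binom v)"
      by (simp add: x mult_single flip: mult.assoc)
    ultimately have "Poly_Mapping.single t 1 * (Poly_Mapping.single 0 c * x) \<in> poly.span proper_multiples"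
      by (simp only:)
    then show ?case unfolding distrib_left using step(2) by (rule poly.span_add)
  qed
  have "G \<subseteq> lattice_ideal V L \<rho>" using Idl_superset[OF G(1)] G(2) by blast
  have "{Poly_Mapping.single t 1 * f | t f. Poly_Mapping.keys t \<subseteq> V \<and> f \<in> G}
      \<subseteq> poly.span (G \<union> proper_multiples)"
  proof clarify
    fix t :: "nat \<Rightarrow>\<^sub>0 nat" and f assume t: "Poly_Mapping.keys t \<subseteq> V" and f: "f \<in> G"
    show "Poly_Mapping.single t 1 * f \<in> poly.span (G \<union> proper_multiples)"
    proof (cases "t = 0")
      case True
      then show ?thesis using f by (auto intro: poly.span_base)
    next
      case False
      then show ?thesis
        using mult[OF t False] f \<open>G \<subseteq> lattice_ideal V L \<rho>\<close>
          poly.span_mono[of proper_multiples "G \<union> proper_multiples"] by blast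
    qed
  qed
  then show ?thesis
    unfolding G(2)[symmetric] Idl_eq_span[OF G(1)] by (rule poly.span_minimal) simp
qed

lemma same_coset:
  assumes "v \<in> L"
  shows "int_vec (t + pos_part v) - w \<in> L \<longleftrightarrow> int_vec (t + pos_part (- v)) - w \<in> L"
proof -
  have "int_vec (t + pos_part v) - w = (int_vec (t + pos_part (- v)) - w) + v"
    using int_vec_pos_part[of v] by (simp add: int_vec_add algebra_simps)
  then show ?thesis
    using L_add[OF _ assms] L_diff[OF _ assms] by (metis add_diff_cancel_right')
qed

text \<open>Nakayama by induction on \<open>fiber_size\<close>: after projection to the coset of the
  first exponent of B(u), each surviving proper multiple x^t B(v) has v of smaller fiber size, so
  B(v) is already in the ideal.\<close>

lemma binomials_generate_if_span:
  assumes pos: "positive_lattice L" and U: "U \<subseteq> L"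
    and span: "binom ` L \<subseteq> poly.span (binom ` U \<union> proper_multiples)"
  shows "Idl\<^bsub>mpoly_ring V\<^esub> (binom ` U) = lattice_ideal V L \<rho>" (is "?J = _")
proof
  have J: "poly_ideal V ?J" by (rule poly_ideal_Idl[OF binomials_polys[OF U]])
  show "?J \<subseteq> lattice_ideal V L \<rho>"
    using U binomial_in_lattice_ideal by (intro Idl_least[OF poly_ideal_lattice_ideal]) auto
  have "binom u \<in> ?J" if "u \<in> L" for u
    using that
  proof (induction "fiber_size (pos_part u)" arbitrary: u rule: less_induct)
    case less
    \<comment> \<open>Both exponents of B(u) lie in this coset, and those of x^t B(v) lie in it
      together or not at all.\<close>
    let ?A = "{s. int_vec s - int_vec (pos_part u) \<in> L}"
    have "restr ?A (binom u) \<in> ?J"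
    proof (rule restr_in_subspace[OF poly_ideal_subspace[OF J]])
      show "binom u \<in> poly.span (binom ` U \<union> proper_multiples)"
        using span less.prems by blast
    next
      fix f assume "f \<in> binom ` U \<union> proper_multiples"
      then consider v where "v \<in> U" "f = binom v"
        | t v where "Poly_Mapping.keys t \<subseteq> V" "t \<noteq> 0" "v \<in> L" "f = Poly_Mapping.single t 1 * binom v"
        unfolding proper_multiples_def by blast
      then show "restr ?A f \<in> ?J"
      proof cases
        case (1 v)
        have "binom v \<in> ?J" using 1(1) Idl_superset[OF binomials_polys[OF U]] by blast
        moreover have "restr ?A (Poly_Mapping.single 0 1 * binom v) =
            (if 0 + pos_part v \<in> ?A then Poly_Mapping.single 0 1 * binom v else 0)"
          by (rule restr_binomial) (use same_coset[of v 0] 1 U in auto)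
        ultimately show ?thesis using 1 poly_idealD(2)[OF J] by simp
      next
        case (2 t v)
        have eq: "restr ?A f = (if t + pos_part v \<in> ?A then f else 0)"
          unfolding 2(4) by (rule restr_binomial) (use same_coset[OF 2(3)] in simp)
        show ?thesis
        proof (cases "t + pos_part v \<in> ?A")
          case True
          have "Poly_Mapping.keys (pos_part v) \<subseteq> V" using L_keys[OF 2(3)] keys_pos_part[of v] by blast
          then have "fiber_size (pos_part v) < fiber_size (pos_part u)"
            using True by (intro fiber_size_less[OF pos 2(1,2)]) auto
          then have "binom v \<in> ?J" using less.hyps 2(3) by blast
          then have "f \<in> ?J" unfolding 2(4) using 2(1) by (intro poly_idealD(4)[OF J]) auto
          then show ?thesis using eq True by simp
        next
          case False
          then show ?thesis using eq poly_idealD(2)[OF J] by simp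
        qed
      qed
    qed
    moreover have "restr ?A (binom u) = binom u"
    proof (rule restr_binomial_1)
      show "pos_part u \<in> ?A" using L_0 by simp
      have "int_vec (pos_part (- u)) - int_vec (pos_part u) = - u"
        using int_vec_pos_part[of u] by (metis minus_diff_eq)
      then show "pos_part (- u) \<in> ?A" using L_uminus[OF less.prems] by simp
    qed
    ultimately show ?case by simp
  qed
  then show "lattice_ideal V L \<rho> \<subseteq> ?J"
    unfolding lattice_ideal_def[of V L] by (intro Idl_least[OF J]) auto
qed

text \<open>G spans the lattice ideal modulo proper multiples, so at most \<open>card G\<close> of
  the binomials already do, and by Nakayama these generate.\<close>

lemma ex_binomial_generators:
  assumes pos: "positive_lattice L"
    and G: "finite G" "G \<subseteq> polys V" "Idl\<^bsub>mpoly_ring V\<^esub> G = lattice_ideal V L \<rho>"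
  obtains U where "U \<subseteq> L" "finite U" "card U \<le> card G"
    "Idl\<^bsub>mpoly_ring V\<^esub> (binom ` U) = lattice_ideal V L \<rho>"
proof -
  have "binom ` L \<subseteq> poly.span (G \<union> proper_multiples)"
    using binomial_in_lattice_ideal generators_span_modulo[OF G(2,3)] by blast
  then obtain W where W: "W \<subseteq> binom ` L" "finite W" "card W \<le> card G"
      "binom ` L \<subseteq> poly.span (W \<union> proper_multiples)"
    using poly.steinitz_modulo[OF G(1)] by metis
  \<comment> \<open>One vector is chosen for each binomial in W, so U is no larger than W.\<close>
  obtain U where U: "U \<subseteq> L" "inj_on binom U" "W = binom ` U"
    using W(1) by (auto simp: subset_image_inj)
  have "finite U" "card U \<le> card G"
    using W U(2) unfolding U(3) by (auto simp: card_image finite_image_iff)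
  then show thesis
    using that U(1) binomials_generate_if_span[OF pos U(1)] W(4) unfolding U(3) by blast
qed

section \<open>Complete intersections among lattice ideals\<close>

lemma rat_rank_le_min_generators:
  assumes "positive_lattice L"
  shows "enat (rat_rank L) \<le> min_generators (mpoly_ring V) (lattice_ideal V L \<rho>)"
  unfolding min_generators_def
proof (rule INF_greatest)
  fix G assume "G \<in> {G. finite G \<and> G \<subseteq> carrier (mpoly_ring V) \<and> Idl\<^bsub>mpoly_ring V\<^esub> G = lattice_ideal V L \<rho>}"
  then obtain U where "U \<subseteq> L" "finite U" "card U \<le> card G"
    "Idl\<^bsub>mpoly_ring V\<^esub> (binom ` U) = lattice_ideal V L \<rho>"
    using ex_binomial_generators[OF assms, of G] by auto
  then show "enat (rat_rank L) \<le> enat (card G)"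
    using rat_rank_le_card[OF _ span_of_binomial_generators] by fastforce
qed

text \<open>The height is \<open>rat_rank L\<close> and the number of generators is never smaller,
  so the condition asks for that many generators, which can be taken to be binomials.\<close>

lemma complete_intersection_iff:
  assumes "positive_lattice L"
  shows "complete_intersection (mpoly_ring V) (lattice_ideal V L \<rho>) \<longleftrightarrow>
    (\<exists>U\<subseteq>L. finite U \<and> card U \<le> rat_rank L \<and> Idl\<^bsub>mpoly_ring V\<^esub> (binom ` U) = lattice_ideal V L \<rho>)"
proof
  assume "complete_intersection (mpoly_ring V) (lattice_ideal V L \<rho>)"
  then have eq: "min_generators (mpoly_ring V) (lattice_ideal V L \<rho>) = enat (rat_rank L)"
    by (simp add: complete_intersection_def ideal_height_lattice_ideal)
  \<comment> \<open>The infimum is attained: without so few generators it would be at least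
    \<open>Suc (rat_rank L)\<close>.\<close>
  have "\<exists>G. finite G \<and> G \<subseteq> polys V \<and> Idl\<^bsub>mpoly_ring V\<^esub> G = lattice_ideal V L \<rho> \<and> card G \<le> rat_rank L"
  proof (rule ccontr)
    assume neg: "\<not> ?thesis"
    have "enat (Suc (rat_rank L)) \<le> min_generators (mpoly_ring V) (lattice_ideal V L \<rho>)"
      unfolding min_generators_def using neg by (intro INF_greatest) (auto simp: not_le Suc_le_eq)
    then show False using eq by simp
  qed
  then obtain G where G: "finite G" "G \<subseteq> polys V" "Idl\<^bsub>mpoly_ring V\<^esub> G = lattice_ideal V L \<rho>"
    "card G \<le> rat_rank L"
    by blast
  obtain U where "U \<subseteq> L" "finite U" "card U \<le> card G"
    "Idl\<^bsub>mpoly_ring V\<^esub> (binom ` U) = lattice_ideal V L \<rho>"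
    by (rule ex_binomial_generators[OF assms G(1-3)])
  then show "\<exists>U\<subseteq>L. finite U \<and> card U \<le> rat_rank L \<and> Idl\<^bsub>mpoly_ring V\<^esub> (binom ` U) = lattice_ideal V L \<rho>"
    using G(4) order_trans by blast
next
  assume "\<exists>U\<subseteq>L. finite U \<and> card U \<le> rat_rank L \<and> Idl\<^bsub>mpoly_ring V\<^esub> (binom ` U) = lattice_ideal V L \<rho>"
  then obtain U where U: "U \<subseteq> L" "finite U" "card U \<le> rat_rank L"
    "Idl\<^bsub>mpoly_ring V\<^esub> (binom ` U) = lattice_ideal V L \<rho>"
    by blast
  have "min_generators (mpoly_ring V) (lattice_ideal V L \<rho>) \<le> enat (card (binom ` U))"
    unfolding min_generators_def using U binomials_polys[OF U(1)] by (intro INF_lower) auto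
  also have "\<dots> \<le> enat (rat_rank L)"
    using card_image_le[OF U(2), of binom] U(3) by simp
  finally show "complete_intersection (mpoly_ring V) (lattice_ideal V L \<rho>)"
    using rat_rank_le_min_generators[OF assms]
    by (simp add: complete_intersection_def ideal_height_lattice_ideal)
qed

text \<open>The hypothesis \<open>face\<close> holds when \<open>W\<close> is the vanishing set of a nonnegative weight that is
  orthogonal to \<open>L\<close>; it makes the substitution \<open>x\<^sub>i = 0\<close> for \<open>i \<notin> W\<close> send each \<open>B u\<close> to itself or to \<open>0\<close>.\<close>

lemma complete_intersection_face:
  assumes pos: "positive_lattice L" and W: "W \<subseteq> V"
    and face: "\<And>u. u \<in> L \<Longrightarrow> Poly_Mapping.keys (pos_part u) \<subseteq> W \<longleftrightarrow> Poly_Mapping.keys (pos_part (- u)) \<subseteq> W"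
    and ci: "complete_intersection (mpoly_ring V) (lattice_ideal V L \<rho>)"
  shows "complete_intersection (mpoly_ring W)
    (lattice_ideal W (L \<inter> carrier (free_Abelian_group W)) \<rho>)"
proof -
  define L' where "L' = L \<inter> carrier (free_Abelian_group W)"
  have L': "u \<in> L' \<longleftrightarrow> u \<in> L \<and> Poly_Mapping.keys u \<subseteq> W" for u
    by (simp add: L'_def)
  interpret sub: lattice_character W L' \<rho>
  proof unfold_locales
    show "finite W" using W finite_V by (rule finite_subset)
    show "u + v \<in> L'" if "u \<in> L'" "v \<in> L'" for u v
      using that L_add keys_add[of u v] unfolding L' by blast
  qed (auto simp: L' L_0 L_uminus rho_0 rho_add)
  have pos': "positive_lattice L'"
    using pos sub.L_0 unfolding positive_lattice_def L'_def by blast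
  obtain U where U: "U \<subseteq> L" "finite U" "card U \<le> rat_rank L"
    "Idl\<^bsub>mpoly_ring V\<^esub> (binom ` U) = lattice_ideal V L \<rho>"
    using ci unfolding complete_intersection_iff[OF pos] by blast
  \<comment> \<open>U spans rationally with no more vectors than the rank, so it is independent, and
    \<open>U'\<close> inherits this; that bounds \<open>card U'\<close> by the rank of
    \<open>L'\<close>.\<close>
  note indep = independent_if_minimal_spanning[OF U(2,3,1) span_of_binomial_generators[OF U(1,4)]]
  define U' where "U' = {u \<in> U. Poly_Mapping.keys u \<subseteq> W}"
  have U': "U' \<subseteq> L'" "U' \<subseteq> U" "finite U'"
    using U(1,2) by (auto simp: U'_def L')
  have card: "card U' \<le> rat_rank L'"
    using U' rat_vec.independent_mono[OF indep(1) image_mono] inj_on_subset[OF indep(2)]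
    by (intro sub.card_le_rat_rank) blast+
  let ?J = "Idl\<^bsub>mpoly_ring W\<^esub> (binom ` U')"
  have J: "poly_ideal W ?J" by (rule poly_ideal_Idl[OF sub.binomials_polys[OF U'(1)]])
  let ?A = "{t. Poly_Mapping.keys t \<subseteq> W}"
  have "binom v \<in> ?J" if v: "v \<in> L'" for v
  proof -
    have "restr ?A (binom v) \<in> ?J"
    proof (rule restr_in_subspace[OF poly_ideal_subspace[OF J]])
      show "binom v \<in> poly.span {Poly_Mapping.single t 1 * f | t f. Poly_Mapping.keys t \<subseteq> V \<and> f \<in> binom ` U}"
        unfolding Idl_eq_span[OF binomials_polys[OF U(1)], symmetric] U(4)
        using v binomial_in_lattice_ideal by (simp add: L')
    next
      fix f assume "f \<in> {Poly_Mapping.single t 1 * f | t f. Poly_Mapping.keys t \<subseteq> V \<and> f \<in> binom ` U}"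
      then obtain t u where f: "f = Poly_Mapping.single t 1 * binom u" "u \<in> U" by blast
      have iff: "Poly_Mapping.keys (pos_part u) \<subseteq> W \<longleftrightarrow> Poly_Mapping.keys (pos_part (- u)) \<subseteq> W"
        using face U(1) f(2) by blast
      then have eq: "restr ?A f = (if t + pos_part u \<in> ?A then f else 0)"
        unfolding f(1) by (intro restr_binomial) (auto simp: keys_plus_nat)
      show "restr ?A f \<in> ?J"
      proof (cases "t + pos_part u \<in> ?A")
        case True
        \<comment> \<open>A surviving multiple has t and, by \<open>iff\<close>, all of u supported
          in W, so u belongs to \<open>U'\<close>.\<close>
        then have t: "Poly_Mapping.keys t \<subseteq> W" and "Poly_Mapping.keys u \<subseteq> W"
          using iff keys_pos_part[of u] by (auto simp: keys_plus_nat)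
        then have "binom u \<in> ?J"
          using f(2) Idl_superset[OF sub.binomials_polys[OF U'(1)]] by (auto simp: U'_def)
        then have "f \<in> ?J" unfolding f(1) using t by (intro poly_idealD(4)[OF J]) auto
        then show ?thesis using eq True by simp
      next
        case False
        then show ?thesis using eq poly_idealD(2)[OF J] by simp
      qed
    qed
    moreover have "restr ?A (binom v) = binom v"
      using v keys_pos_part[of v] by (intro restr_binomial_1) (auto simp: L')
    ultimately show ?thesis by simp
  qed
  then have "lattice_ideal W L' \<rho> \<subseteq> ?J"
    unfolding lattice_ideal_def by (intro Idl_least[OF J]) auto
  moreover have "?J \<subseteq> lattice_ideal W L' \<rho>"
    using U'(1) sub.binomial_in_lattice_ideal by (intro Idl_least[OF sub.poly_ideal_lattice_ideal]) auto
  ultimately show ?thesis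
    using U' card sub.complete_intersection_iff[OF pos'] unfolding L'_def by blast
qed

end

section \<open>Faces of the cone\<close>

lemma partial_character_lattice_character:
  assumes "partial_character m L \<rho>"
  shows "lattice_character {1..m} L \<rho>"
proof -
  let ?G = "free_Abelian_group {1..m}"
  have sub: "subgroup L ?G"
    and hom: "\<rho> \<in> hom (?G\<lparr>carrier := L\<rparr>) (Multiplicative_Group.mult_of (ring_of_type_algebra :: 'a ring))"
    using assms by (auto simp: partial_character_def)
  have keys: "Poly_Mapping.keys u \<subseteq> {1..m}" if "u \<in> L" for u
    using subsetD[OF subgroup.subset[OF sub] that] by simp
  have zero: "0 \<in> L" using subgroup.one_closed[OF sub] by simp
  have add: "\<rho> (u + v) = \<rho> u * \<rho> v" if "u \<in> L" "v \<in> L" for u v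
    using hom_mult[OF hom, of u v] that by (simp add: ring_of_type_algebra_def)
  \<comment> \<open>A nonzero element equal to its own square is 1.\<close>
  have "\<rho> 0 \<noteq> 0"
    using hom_in_carrier[OF hom, of 0] zero by (simp add: ring_of_type_algebra_def)
  then have "\<rho> 0 = 1" using add[OF zero zero] by simp
  then show ?thesis
    using keys zero add subgroup.m_closed[OF sub] subgroup.m_inv_closed[OF sub]
    by unfold_locales auto
qed

lemma subgroup_saturation:
  assumes "lattice {1..m} L"
  shows "subgroup (saturation m L) (free_Abelian_group {1..m})"
proof -
  interpret lattice "{1..m}" L by fact
  show ?thesis
  proof (rule group.subgroupI)
    show "saturation m L \<noteq> {}"
    proof -
      have "frag_cmul 1 0 \<in> L" using L_0 by simp
      then have "0 \<in> saturation m L" unfolding saturation_def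
        by (intro CollectI conjI exI[of _ 1]) simp_all
      then show ?thesis by blast
    qed
  next
    fix u assume "u \<in> saturation m L"
    then obtain d :: int where "d \<noteq> 0" "frag_cmul d u \<in> L" "Poly_Mapping.keys u \<subseteq> {1..m}"
      by (auto simp: saturation_def)
    moreover have "frag_cmul d (- u) = - frag_cmul d u" by (rule poly_mapping_eqI) simp
    ultimately have "d \<noteq> 0 \<and> frag_cmul d (- u) \<in> L \<and> Poly_Mapping.keys u \<subseteq> {1..m}"
      using L_uminus[of "frag_cmul d u"] by (simp only: simp_thms)
    then show "inv\<^bsub>free_Abelian_group {1..m}\<^esub> u \<in> saturation m L"
      unfolding saturation_def by (intro CollectI conjI exI[of _ d]) simp_all
  next
    fix u v assume "u \<in> saturation m L" "v \<in> saturation m L"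
    then obtain d e :: int where u: "d \<noteq> 0" "frag_cmul d u \<in> L" "Poly_Mapping.keys u \<subseteq> {1..m}"
      and v: "e \<noteq> 0" "frag_cmul e v \<in> L" "Poly_Mapping.keys v \<subseteq> {1..m}"
      by (auto simp: saturation_def)
    have "frag_cmul e (frag_cmul d u) + frag_cmul d (frag_cmul e v) \<in> L"
      by (rule L_add[OF L_cmul[OF u(2)] L_cmul[OF v(2)]])
    then have "frag_cmul (d * e) (u + v) \<in> L"
      by (simp add: frag_cmul_distrib2 mult.commute)
    moreover have "Poly_Mapping.keys (u + v) \<subseteq> {1..m}"
      using keys_add[of u v] u v by blast
    ultimately show "u \<otimes>\<^bsub>free_Abelian_group {1..m}\<^esub> v \<in> saturation m L"
      using u(1) v(1) unfolding saturation_def by (intro CollectI conjI exI[of _ "d * e"]) simp_all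
  qed (auto simp: saturation_def)
qed

text \<open>Pairing c with the image under \<psi> of a coset gives an additive map on the integer
  vectors. It takes the value c a_i at e_i and vanishes on L, which lies in its saturation.\<close>

lemma orthogonal_to_lattice:
  fixes c :: "nat \<Rightarrow> rat"
  assumes L: "lattice {1..m} L"
    and hom: "\<psi> \<in> hom (free_Abelian_group {1..m} Mod saturation m L) (free_Abelian_group {1..n})"
    and u: "u \<in> L"
  shows "(\<Sum>i\<in>{1..m}. of_int (Poly_Mapping.lookup u i) * (\<Sum>j\<in>{1..n}. c j * lattice_vec m L \<psi> i j)) = 0"
proof -
  interpret lattice "{1..m}" L by fact
  let ?G = "free_Abelian_group {1..m}" and ?S = "saturation m L"
  interpret G: comm_group ?G by (rule abelian_free_Abelian_group)
  have sub: "subgroup ?S ?G" by (rule subgroup_saturation[OF L])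
  interpret N: normal ?S ?G by (rule G.subgroup_imp_normal[OF sub])
  define \<theta> where "\<theta> = (\<lambda>v. \<psi> (?S #>\<^bsub>?G\<^esub> v))"
  have add: "\<theta> (v + w) = \<theta> v + \<theta> w" if "Poly_Mapping.keys v \<subseteq> {1..m}" "Poly_Mapping.keys w \<subseteq> {1..m}" for v w
  proof -
    have "\<theta> (v + w) = \<psi> ((?S #>\<^bsub>?G\<^esub> v) \<otimes>\<^bsub>?G Mod ?S\<^esub> (?S #>\<^bsub>?G\<^esub> w))"
      using N.rcos_sum[of v w] that by (simp add: \<theta>_def)
    also have "\<dots> = \<theta> v + \<theta> w"
      using that by (subst hom_mult[OF hom]) (auto simp: \<theta>_def FactGroup_def RCOSETS_def)
    finally show ?thesis .
  qed
  define w where "w = (\<lambda>v. \<Sum>j\<in>{1..n}. c j * of_int (Poly_Mapping.lookup (\<theta> v) j))"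
  have w_add: "w (v + v') = w v + w v'" if "Poly_Mapping.keys v \<subseteq> {1..m}" "Poly_Mapping.keys v' \<subseteq> {1..m}" for v v'
    using add[OF that] by (simp add: w_def lookup_add algebra_simps sum.distrib)
  have w_0: "w 0 = 0" using w_add[of 0 0] by simp
  have w_diff: "w (v - v') = w v - w v'" if "Poly_Mapping.keys v \<subseteq> {1..m}" "Poly_Mapping.keys v' \<subseteq> {1..m}" for v v'
  proof -
    have "Poly_Mapping.keys (v - v') \<subseteq> {1..m}" using keys_diff[of v v'] that by blast
    from w_add[OF this that(2)] show ?thesis by simp
  qed
  \<comment> \<open>The support condition is part of the induction because \<open>w_diff\<close>
    holds for vectors supported in \<open>{1..m}\<close>.\<close>
  have "Poly_Mapping.keys u \<subseteq> {1..m} \<and> w u = (\<Sum>i\<in>{1..m}. of_int (Poly_Mapping.lookup u i) * w (frag_of i))"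
    using L_keys[OF u]
  proof (induction u rule: frag_induction)
    case zero
    then show ?case by (simp add: w_0)
  next
    case (one i)
    have "(\<Sum>k\<in>{1..m}. of_int (Poly_Mapping.lookup (frag_of i) k) * w (frag_of k))
        = (\<Sum>k\<in>{1..m}. if k = i then w (frag_of i) else 0)"
      by (intro sum.cong) auto
    then show ?case using one by simp
  next
    case (diff v v')
    then show ?case
      using keys_diff[of v v'] by (auto simp: w_diff lookup_minus algebra_simps sum_subtractf)
  qed
  moreover have "w u = 0"
  proof -
    have "u \<in> ?S" "0 \<in> ?S"
      using u L_keys[OF u] L_0 by (auto simp: saturation_def intro!: exI[of _ 1])
    then have "?S #>\<^bsub>?G\<^esub> u = ?S #>\<^bsub>?G\<^esub> 0"
      using G.coset_join2[of _ ?S, OF _ sub] L_keys[OF u] by simp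
    then show ?thesis using w_0 by (simp add: w_def \<theta>_def)
  qed
  moreover have "w (frag_of i) = (\<Sum>j\<in>{1..n}. c j * lattice_vec m L \<psi> i j)" for i
    by (simp add: w_def \<theta>_def lattice_vec_def)
  ultimately show ?thesis by simp
qed

lemma generator_in_pos_hull:
  assumes "i \<in> {1..m}"
  shows "a i \<in> pos_hull m a"
proof -
  have "(\<Sum>k\<in>{1..m}. (if k = i then 1 else 0) * a k j) = (\<Sum>k\<in>{1..m}. if k = i then a i j else 0)" for j
    by (intro sum.cong) auto
  then have "a i = (\<lambda>j. \<Sum>k\<in>{1..m}. (if k = i then 1 else 0) * a k j)"
    using assms by auto
  then show ?thesis
    unfolding pos_hull_def by (intro CollectI exI[of _ "\<lambda>k. if k = i then 1 else 0"]) auto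
qed

text \<open>A sum of nonnegative terms vanishes only termwise. Support in the face thus becomes one
  equation about the weight of an exponent.\<close>

lemma zero_weight_iff:
  fixes w :: "nat \<Rightarrow> rat"
  assumes "finite V" "\<And>i. i \<in> V \<Longrightarrow> 0 \<le> w i" "Poly_Mapping.keys t \<subseteq> V"
  shows "Poly_Mapping.keys t \<subseteq> {i \<in> V. w i = 0} \<longleftrightarrow> (\<Sum>i\<in>V. of_nat (Poly_Mapping.lookup t i) * w i) = 0"
proof -
  have "(\<Sum>i\<in>V. of_nat (Poly_Mapping.lookup t i) * w i) = 0 \<longleftrightarrow>
      (\<forall>i\<in>V. of_nat (Poly_Mapping.lookup t i) * w i = 0)"
    using assms by (intro sum_nonneg_eq_0_iff) auto
  then show ?thesis using assms(3) by (auto simp: in_keys_iff)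
qed

theorem theorem4p1:
  fixes m n :: nat
    and L :: "(nat \<Rightarrow>\<^sub>0 int) set"
    and \<rho> :: "(nat \<Rightarrow>\<^sub>0 int) \<Rightarrow> 'k::field"
    and \<psi> :: "(nat \<Rightarrow>\<^sub>0 int) set \<Rightarrow> (nat \<Rightarrow>\<^sub>0 int)"
    and a :: "nat \<Rightarrow> (nat \<Rightarrow> rat)"
    and \<sigma> :: "(nat \<Rightarrow> rat) set"
  assumes "partial_character m L \<rho>"
    and "L \<noteq> {0}"
    and "positive_lattice L"
    and "n = m - lattice_rank L"
    and "\<psi> \<in> iso (free_Abelian_group {1..m} Mod saturation m L) (free_Abelian_group {1..n})"
  defines "a \<equiv> lattice_vec m L \<psi>"
    and "\<sigma> \<equiv> pos_hull m a"
  shows "complete_intersection (mpoly_ring {1..m}) (lattice_ideal {1..m} L \<rho>) \<longleftrightarrow>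
         (\<forall>F. cone_face n \<sigma> F \<longrightarrow>
            complete_intersection (mpoly_ring (indices_in m a F))
              (lattice_ideal (indices_in m a F)
                 (L \<inter> carrier (free_Abelian_group (indices_in m a F))) \<rho>))"
proof (intro iffI allI impI)
  interpret lattice_character "{1..m}" L \<rho>
    by (rule partial_character_lattice_character) fact
  assume ci: "complete_intersection (mpoly_ring {1..m}) (lattice_ideal {1..m} L \<rho>)"
  fix F assume "cone_face n \<sigma> F"
  then obtain c where c: "\<forall>x\<in>\<sigma>. 0 \<le> (\<Sum>j\<in>{1..n}. c j * x j)"
    and F: "F = {x \<in> \<sigma>. (\<Sum>j\<in>{1..n}. c j * x j) = 0}"
    unfolding cone_face_def by blast
  \<comment> \<open>The functional of the face evaluated at the generators a_i; the variables of the
    face are those of weight 0.\<close>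
  define w where "w = (\<lambda>i. \<Sum>j\<in>{1..n}. c j * a i j)"
  have \<sigma>: "a i \<in> \<sigma>" if "i \<in> {1..m}" for i
    unfolding \<sigma>_def by (rule generator_in_pos_hull[OF that])
  have w_nonneg: "0 \<le> w i" if "i \<in> {1..m}" for i
    using c \<sigma>[OF that] by (simp add: w_def)
  have E: "indices_in m a F = {i \<in> {1..m}. w i = 0}"
    using \<sigma> by (auto simp: indices_in_def F w_def)
  show "complete_intersection (mpoly_ring (indices_in m a F))
      (lattice_ideal (indices_in m a F) (L \<inter> carrier (free_Abelian_group (indices_in m a F))) \<rho>)"
  proof (rule complete_intersection_face[OF assms(3) _ _ ci])
    fix u assume u: "u \<in> L"
    have keys: "Poly_Mapping.keys (pos_part u) \<subseteq> {1..m}" "Poly_Mapping.keys (pos_part (- u)) \<subseteq> {1..m}"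
      using L_keys[OF u] keys_pos_part[of u] by auto
    \<comment> \<open>Orthogonality to u says that its positive and negative parts have equal
      weight, so one is supported in the face iff the other is.\<close>
    have "0 = (\<Sum>i\<in>{1..m}. of_int (Poly_Mapping.lookup u i) * w i)"
      using orthogonal_to_lattice[OF lattice_axioms _ u, of \<psi> n c] assms(5)
      by (simp add: w_def a_def iso_def)
    also have "\<dots> = (\<Sum>i\<in>{1..m}. of_nat (Poly_Mapping.lookup (pos_part u) i) * w i
        - of_nat (Poly_Mapping.lookup (pos_part (- u)) i) * w i)"
      by (intro sum.cong) (auto simp: lookup_pos_part left_diff_distrib[symmetric])
    finally have "(\<Sum>i\<in>{1..m}. of_nat (Poly_Mapping.lookup (pos_part u) i) * w i)
        = (\<Sum>i\<in>{1..m}. of_nat (Poly_Mapping.lookup (pos_part (- u)) i) * w i)"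
      by (simp add: sum_subtractf)
    then show "Poly_Mapping.keys (pos_part u) \<subseteq> indices_in m a F \<longleftrightarrow>
        Poly_Mapping.keys (pos_part (- u)) \<subseteq> indices_in m a F"
      unfolding E using zero_weight_iff[OF finite_V w_nonneg keys(1)] zero_weight_iff[OF finite_V w_nonneg keys(2)]
      by simp
  qed (auto simp: indices_in_def)
next
  assume *: "\<forall>F. cone_face n \<sigma> F \<longrightarrow>
    complete_intersection (mpoly_ring (indices_in m a F))
      (lattice_ideal (indices_in m a F) (L \<inter> carrier (free_Abelian_group (indices_in m a F))) \<rho>)"
  interpret lattice_character "{1..m}" L \<rho>
    by (rule partial_character_lattice_character) fact
  \<comment> \<open>The zero functional cuts out the whole cone, which contains every a_i.\<close>
  have "cone_face n \<sigma> \<sigma>"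
    unfolding cone_face_def by (intro exI[of _ "\<lambda>_. 0"]) simp
  moreover have "indices_in m a \<sigma> = {1..m}"
    using generator_in_pos_hull by (auto simp: indices_in_def \<sigma>_def)
  moreover have "L \<inter> carrier (free_Abelian_group {1..m}) = L"
    using L_keys by auto
  ultimately show "complete_intersection (mpoly_ring {1..m}) (lattice_ideal {1..m} L \<rho>)"
    using * by metis
qed

end
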